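(* Let $n\ge 2$ and $1\le s\le n$ be integers, let $r_1,\dots,r_s$ be positive integers with $r_1+\dots+r_s=n$, and let $\mathbb E_E=\mathbb E_{n;s;r_1,\dots,r_s}\subset\mathbb C^N$ be the corresponding generalized tetrablock. Then $\mathbb E_E$ cannot be exhausted by domains biholomorphic to convex ones.
   Context: Given integers $n\ge 2$, $1\le s\le n$ and positive integers $r_1,\dots,r_s$ with $\sum_{j=1}^s r_j=n$, let $A(r_1,\dots,r_s)=\{0,\dots,r_1\}\times\dots\times\{0,\dots,r_s\}\setminus\{(0,\dots,0)\}$, totally ordered by: for $\alpha\ne\beta$, $\alpha<\beta$ iff $\alpha_{j_0}<\beta_{j_0}$ where $j_0=\max\{j:\alpha_j\ne\beta_j\}$. Write $A(r_1,\dots,r_s)=\{\alpha^1<\dots<\alpha^N\}$, $N=\prod_{j=1}^s(r_j+1)-1$. For $x\in\mathbb C^N$, $z\in\mathbb C^s$ put $R_x(z)=1+\sum_{j=1}^N(-1)^{|\alpha^j|}x_jz^{\alpha^j}$, where $|\alpha|=\alpha_1+\dots+\alpha_s$ and $z^\alpha=z_1^{\alpha_1}\cdots z_s^{\alpha_s}$. With $\mathbb D$ the open unit disc in $\mathbb C$, the generalized tetrablock is $\mathbb E_E=\mathbb E_{n;s;r_1,\dots,r_s}=\{x\in\mathbb C^N: R_x(z)\neq 0\text{ for all }z\in\overline{\mathbb D}^s\}$ (here $E$ only refers to the space of matrices $\operatorname{diag}[z_1\mathbb I_{r_1},\dots,z_s\mathbb I_{r_s}]$). A domain $D\subset\mathbb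 C^N$ can be exhausted by domains biholomorphic to convex ones if there are domains $D_1\subset D_2\subset\cdots$ with $\bigcup_{j}D_j=D$ such that each $D_j$ is biholomorphic to a convex domain. *)

theory Defs
  imports "HOL-Analysis.Analysis"
begin

section \<open>Several complex variables\<close>

definition holomorphic_map_on ::
    "((complex ^ 'n) \<Rightarrow> (complex ^ 'm)) \<Rightarrow> (complex ^ 'n) set \<Rightarrow> bool" where
  "holomorphic_map_on f D \<longleftrightarrow>
     (\<forall>x\<in>D. \<exists>L. (f has_derivative L) (at x) \<and> Vector_Spaces.linear (*s) (*s) L)"

text \<open>Meant for open sets: the derivative is taken in a full neighbourhood of each point,
  and the real Frechet derivative is required to be complex linear.\<close>

definition biholomorphic_map ::
    "((complex ^ 'n) \<Rightarrow> (complex ^ 'm)) \<Rightarrow> (complex ^ 'n) set \<Rightarrow> (complex ^ 'm) set \<Rightarrow> bool" where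
  "biholomorphic_map f D G \<longleftrightarrow>
     bij_betw f D G \<and> holomorphic_map_on f D \<and> holomorphic_map_on (inv_into D f) G"

definition domain_in :: "(complex ^ 'n) set \<Rightarrow> bool" where
  "domain_in D \<longleftrightarrow> open D \<and> connected D \<and> D \<noteq> {}"

definition biholomorphic_to_convex :: "(complex ^ 'n) set \<Rightarrow> bool" where
  "biholomorphic_to_convex D \<longleftrightarrow>
     (\<exists>(G :: (complex ^ 'n) set) f. domain_in G \<and> convex G \<and> biholomorphic_map f D G)"

text \<open>The inclusions between the exhausting domains need not be strict. A set that can be
  exhausted in this sense is automatically a domain.\<close>

definition exhausted_by_convex :: "(complex ^ 'n) set \<Rightarrow> bool" where
  "exhausted_by_convex D \<longleftrightarrow>
     (\<exists>E :: nat \<Rightarrow> (complex ^ 'n) set.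
        (\<forall>k. domain_in (E k) \<and> biholomorphic_to_convex (E k)) \<and>
        (\<forall>k. E k \<subseteq> E (Suc k)) \<and> (\<Union>k. E k) = D)"

section \<open>Multi-indices\<close>

text \<open>The tuple \<open>(r\<^sub>1, \<dots>, r\<^sub>s)\<close> is given by a function \<open>r\<close>, used only on \<open>{1..s}\<close>. Multi-indices are
  extensional functions on \<open>{1..s}\<close>, so that equal tuples are equal functions.\<close>

definition multi_indices :: "nat \<Rightarrow> (nat \<Rightarrow> nat) \<Rightarrow> (nat \<Rightarrow> nat) set" where
  "multi_indices s r = (\<Pi>\<^sub>E j\<in>{1..s}. {0..r j}) - {\<lambda>j\<in>{1..s}. 0}"

definition num_indices :: "nat \<Rightarrow> (nat \<Rightarrow> nat) \<Rightarrow> nat" where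
  "num_indices s r = (\<Prod>j=1..s. (r j + 1)) - 1"

definition mi_less :: "nat \<Rightarrow> (nat \<Rightarrow> nat) \<Rightarrow> (nat \<Rightarrow> nat) \<Rightarrow> bool" where
  "mi_less s \<alpha> \<beta> \<longleftrightarrow>
     \<alpha> \<noteq> \<beta> \<and> (let j0 = Max {j\<in>{1..s}. \<alpha> j \<noteq> \<beta> j} in \<alpha> j0 < \<beta> j0)"

text \<open>The \<open>k\<close>-th multi-index, \<open>1 \<le> k \<le> N\<close>, is the one having exactly \<open>k - 1\<close> predecessors.
  See \<open>nth_index_bij\<close> and \<open>nth_index_mono\<close>.\<close>

definition nth_index :: "nat \<Rightarrow> (nat \<Rightarrow> nat) \<Rightarrow> nat \<Rightarrow> (nat \<Rightarrow> nat)" where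
  "nth_index s r k =
     (THE \<alpha>. \<alpha> \<in> multi_indices s r \<and>
        card {\<beta> \<in> multi_indices s r. mi_less s \<beta> \<alpha>} + 1 = k)"

section \<open>The generalized tetrablock\<close>

text \<open>The index type \<open>'n\<close> of \<open>complex ^ 'n\<close> carries no numbering of its own, so \<open>c\<close> numbers the
  coordinates: \<open>x\<^sub>k\<close> is \<open>x $ c k\<close> for \<open>1 \<le> k \<le> N\<close>, with \<open>c\<close> a bijection from \<open>{1..N}\<close> to \<open>'n\<close>.\<close>

definition tetra_poly ::
    "nat \<Rightarrow> (nat \<Rightarrow> nat) \<Rightarrow> (nat \<Rightarrow> 'n) \<Rightarrow> (complex ^ 'n) \<Rightarrow> (nat \<Rightarrow> complex) \<Rightarrow> complex" where
  "tetra_poly s r c x z =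
     1 + (\<Sum>k=1..num_indices s r.
            (- 1) ^ (\<Sum>j=1..s. nth_index s r k j) * x $ c k * (\<Prod>j=1..s. z j ^ nth_index s r k j))"

definition gen_tetrablock ::
    "nat \<Rightarrow> (nat \<Rightarrow> nat) \<Rightarrow> (nat \<Rightarrow> 'n) \<Rightarrow> (complex ^ 'n) set" where
  "gen_tetrablock s r c =
     {x. \<forall>z \<in> {1..s} \<rightarrow> cball 0 1. tetra_poly s r c x z \<noteq> 0}"

section \<open>The enumeration of the multi-indices\<close>

lemma finite_multi_indices: "finite (multi_indices s r)"
  unfolding multi_indices_def by (intro finite_Diff finite_PiE) auto

lemma card_multi_indices: "card (multi_indices s r) = num_indices s r"
proof -
  have "(\<lambda>j\<in>{1..s}. 0) \<in> (\<Pi>\<^sub>E j\<in>{1..s}. {0..r j})" by auto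
  then show ?thesis
    unfolding multi_indices_def num_indices_def
    by (simp add: card_Diff_singleton card_PiE)
qed

lemma mi_less_iff:
  assumes "\<alpha> \<in> multi_indices s r" "\<beta> \<in> multi_indices s r"
  shows "mi_less s \<alpha> \<beta> \<longleftrightarrow>
    (\<exists>j\<in>{1..s}. \<alpha> j < \<beta> j \<and> (\<forall>i\<in>{1..s}. j < i \<longrightarrow> \<alpha> i = \<beta> i))" (is "_ \<longleftrightarrow> ?R")
proof -
  let ?S = "{j\<in>{1..s}. \<alpha> j \<noteq> \<beta> j}"
  have fin: "finite ?S" by simp
  have ne: "?S \<noteq> {}" if "\<alpha> \<noteq> \<beta>"
  proof
    assume "?S = {}"
    moreover have "\<alpha> \<in> extensional {1..s}" "\<beta> \<in> extensional {1..s}"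
      using assms by (auto simp: multi_indices_def PiE_def)
    ultimately have "\<alpha> = \<beta>" by (intro extensionalityI) auto
    with that show False by simp
  qed
  show ?thesis
  proof
    assume "mi_less s \<alpha> \<beta>"
    then have *: "\<alpha> \<noteq> \<beta>" "\<alpha> (Max ?S) < \<beta> (Max ?S)" by (auto simp: mi_less_def Let_def)
    have "Max ?S \<in> ?S" using fin ne[OF *(1)] by (rule Max_in)
    moreover have "\<alpha> i = \<beta> i" if "i \<in> {1..s}" "Max ?S < i" for i
    proof (rule ccontr)
      assume "\<alpha> i \<noteq> \<beta> i"
      then have "i \<in> ?S" using that(1) by blast
      then have "i \<le> Max ?S" by (rule Max_ge[OF fin])
      with that(2) show False by linarith
    qed
    ultimately show ?R using *(2) by blast
  next
    assume ?R
    then obtain j where j: "j \<in> {1..s}" "\<alpha> j < \<beta> j" "\<forall>i\<in>{1..s}. j < i \<longrightarrow> \<alpha> i = \<beta> i" by blast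
    have "Max ?S = j"
    proof (rule Max_eqI[OF fin])
      fix y assume "y \<in> ?S"
      then show "y \<le> j" using j(3) by (metis (mono_tags, lifting) mem_Collect_eq not_le)
    next
      show "j \<in> ?S" using j by simp
    qed
    with j show "mi_less s \<alpha> \<beta>" by (auto simp: mi_less_def Let_def)
  qed
qed

lemma mi_less_irrefl: "\<not> mi_less s \<alpha> \<alpha>"
  by (simp add: mi_less_def)

lemma mi_less_trans:
  assumes "\<alpha> \<in> multi_indices s r" "\<beta> \<in> multi_indices s r" "\<gamma> \<in> multi_indices s r"
    and "mi_less s \<alpha> \<beta>" "mi_less s \<beta> \<gamma>"
  shows "mi_less s \<alpha> \<gamma>"
proof -
  obtain i where i: "i \<in> {1..s}" "\<alpha> i < \<beta> i" "\<forall>k\<in>{1..s}. i < k \<longrightarrow> \<alpha> k = \<beta> k"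
    using assms by (auto simp: mi_less_iff)
  obtain j where j: "j \<in> {1..s}" "\<beta> j < \<gamma> j" "\<forall>k\<in>{1..s}. j < k \<longrightarrow> \<beta> k = \<gamma> k"
    using assms by (auto simp: mi_less_iff)
  have "max i j \<in> {1..s}" using i(1) j(1) by (simp add: max_def)
  moreover have "\<alpha> (max i j) < \<gamma> (max i j)"
  proof (cases i j rule: linorder_cases)
    case less with i j show ?thesis by (simp add: max_def)
  next
    case equal with i j show ?thesis by simp
  next
    case greater
    then have "\<beta> i = \<gamma> i" using i(1) j(3) by blast
    with greater i show ?thesis by (simp add: max_def)
  qed
  moreover have "\<forall>k\<in>{1..s}. max i j < k \<longrightarrow> \<alpha> k = \<gamma> k" using i(3) j(3) by simp
  ultimately show ?thesis using assms(1,3) by (subst mi_less_iff) blast+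
qed

lemma mi_less_total:
  assumes "\<alpha> \<in> multi_indices s r" "\<beta> \<in> multi_indices s r" "\<alpha> \<noteq> \<beta>"
  shows "mi_less s \<alpha> \<beta> \<or> mi_less s \<beta> \<alpha>"
proof -
  let ?S = "{j\<in>{1..s}. \<alpha> j \<noteq> \<beta> j}"
  have "?S \<noteq> {}"
  proof
    assume "?S = {}"
    moreover have "\<alpha> \<in> extensional {1..s}" "\<beta> \<in> extensional {1..s}"
      using assms by (auto simp: multi_indices_def PiE_def)
    ultimately have "\<alpha> = \<beta>" by (intro extensionalityI) auto
    with assms show False by simp
  qed
  then have "Max ?S \<in> ?S" by (intro Max_in) auto
  then have "\<alpha> (Max ?S) \<noteq> \<beta> (Max ?S)" by blast
  moreover have "{j\<in>{1..s}. \<beta> j \<noteq> \<alpha> j} = ?S" by auto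
  ultimately show ?thesis using assms(3) by (auto simp: mi_less_def Let_def)
qed

definition mi_rank :: "nat \<Rightarrow> (nat \<Rightarrow> nat) \<Rightarrow> (nat \<Rightarrow> nat) \<Rightarrow> nat" where
  "mi_rank s r \<alpha> = card {\<beta> \<in> multi_indices s r. mi_less s \<beta> \<alpha>} + 1"

lemma mi_rank_mono:
  assumes "\<alpha> \<in> multi_indices s r" "\<beta> \<in> multi_indices s r" "mi_less s \<alpha> \<beta>"
  shows "mi_rank s r \<alpha> < mi_rank s r \<beta>"
proof -
  have "{\<gamma> \<in> multi_indices s r. mi_less s \<gamma> \<alpha>} \<subset> {\<gamma> \<in> multi_indices s r. mi_less s \<gamma> \<beta>}"
    using assms mi_less_trans[of _ s r \<alpha> \<beta>] mi_less_irrefl by blast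
  then show ?thesis unfolding mi_rank_def
    by (simp add: psubset_card_mono finite_multi_indices)
qed

lemma mi_rank_bij: "bij_betw (mi_rank s r) (multi_indices s r) {1..num_indices s r}"
proof -
  have inj: "inj_on (mi_rank s r) (multi_indices s r)"
    by (rule inj_onI) (metis mi_rank_mono mi_less_total less_irrefl)
  have "mi_rank s r \<alpha> \<in> {1..num_indices s r}" if "\<alpha> \<in> multi_indices s r" for \<alpha>
  proof -
    have "{\<beta> \<in> multi_indices s r. mi_less s \<beta> \<alpha>} \<subset> multi_indices s r"
      using that mi_less_irrefl by blast
    then have "card {\<beta> \<in> multi_indices s r. mi_less s \<beta> \<alpha>} < num_indices s r"
      using psubset_card_mono[OF finite_multi_indices] card_multi_indices by metis
    then show ?thesis by (simp add: mi_rank_def)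
  qed
  then have "mi_rank s r ` multi_indices s r \<subseteq> {1..num_indices s r}" by blast
  moreover have "card (mi_rank s r ` multi_indices s r) = card {1..num_indices s r}"
    using card_image[OF inj] card_multi_indices by simp
  ultimately have "mi_rank s r ` multi_indices s r = {1..num_indices s r}"
    by (intro card_subset_eq) auto
  with inj show ?thesis by (simp add: bij_betw_def)
qed

lemma nth_index_mi_rank:
  assumes "\<alpha> \<in> multi_indices s r"
  shows "nth_index s r (mi_rank s r \<alpha>) = \<alpha>"
  unfolding nth_index_def mi_rank_def[symmetric]
  using assms mi_rank_bij[of s r]
  by (intro the_equality) (auto simp: bij_betw_def inj_on_def)

lemma nth_index_bij: "bij_betw (nth_index s r) {1..num_indices s r} (multi_indices s r)"
proof (rule bij_betw_byWitness[where f' = "mi_rank s r"])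
  have img: "mi_rank s r ` multi_indices s r = {1..num_indices s r}"
    using mi_rank_bij by (rule bij_betw_imp_surj_on)
  then show "\<forall>k\<in>{1..num_indices s r}. mi_rank s r (nth_index s r k) = k"
    using nth_index_mi_rank by (metis imageE)
  show "\<forall>\<alpha>\<in>multi_indices s r. nth_index s r (mi_rank s r \<alpha>) = \<alpha>"
    using nth_index_mi_rank by blast
  show "nth_index s r ` {1..num_indices s r} \<subseteq> multi_indices s r"
    unfolding img[symmetric] by (auto simp: nth_index_mi_rank)
  show "mi_rank s r ` multi_indices s r \<subseteq> {1..num_indices s r}" using img by simp
qed

lemma nth_index_mono:
  assumes "k \<in> {1..num_indices s r}" "l \<in> {1..num_indices s r}" "k < l"
  shows "mi_less s (nth_index s r k) (nth_index s r l)"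
proof -
  obtain \<alpha> \<beta> where ab: "\<alpha> \<in> multi_indices s r" "k = mi_rank s r \<alpha>"
      "\<beta> \<in> multi_indices s r" "l = mi_rank s r \<beta>"
    using assms(1,2) mi_rank_bij[of s r] unfolding bij_betw_def by blast
  then have "mi_less s \<alpha> \<beta>"
    using assms(3) mi_less_total mi_rank_mono by (metis less_asym less_irrefl)
  with ab show ?thesis by (simp add: nth_index_mi_rank)
qed

end

theory Submission
  imports Defs "HOL-Complex_Analysis.Conformal_Mappings"
begin

text \<open>Let \<open>D\<close> be the generalized tetrablock. Give the variable \<open>z\<^sub>j\<close> a positive integer weight \<open>m\<^sub>j\<close> and the
coordinate belonging to the multi-index \<open>\<alpha>\<close> the weight \<open>\<langle>m, \<alpha>\<rangle>\<close>. Since the polydisc is invariant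
under \<open>z\<^sub>j \<mapsto> l ^ m\<^sub>j z\<^sub>j\<close> for \<open>\<bar>l\<bar> \<le> 1\<close>, the set \<open>D\<close> is mapped into itself by the weighted dilations,
which multiply each coordinate by the power of \<open>l\<close> prescribed by its weight. Moreover \<open>D\<close> has a
disc property: a holomorphic disc whose boundary circle lies in \<open>D\<close> has its centre in \<open>D\<close>, because
a polynomial without zeros can be deformed to the constant \<open>1\<close> by shrinking its argument.

Suppose that \<open>D\<close> is exhausted by domains \<open>E\<close> with biholomorphic maps \<open>f\<close> onto convex domains.
For \<open>b\<close> and \<open>c\<close> in \<open>D\<close> some \<open>E\<close> contains all dilates \<open>\<pi>\<^sub>l b\<close> and \<open>\<pi>\<^sub>l c\<close>, and one can pull back the
convex combination \<open>(1 - t) f (\<pi>\<^sub>l b) + t f (\<pi>\<^sub>l c)\<close> to a holomorphic curve \<open>h\<close> in \<open>E\<close>. If \<open>b\<close> and \<open>c\<close>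
only involve coordinates of weight at least \<open>\<kappa>\<close>, where no weight exceeds \<open>2 \<kappa>\<close>, then the nonlinear
part of \<open>f\<close> disturbs \<open>h\<close> only by terms of order \<open>l ^ (2 \<kappa>)\<close>. So \<open>h l\<close> can be divided by the dilation,
and the disc property puts the value at \<open>l = 0\<close> into \<open>D\<close>. This value is \<open>(1 - t) b + t c\<close> up to an
error \<open>y\<close> in the coordinates of weight exactly \<open>2 \<kappa>\<close>, and \<open>y\<close> does not change when \<open>b\<close> and \<open>c\<close> are
changed in coordinates of weight above \<open>\<kappa>\<close>. This is \<open>gen_tetrablock_convex_combination\<close>. Two ways of
contradicting it cover all cases.

If there are two multi-indices \<open>\<alpha>\<close> and \<open>\<beta>\<close> of equal weight with \<open>\<alpha> + \<beta> = r\<close>, put \<open>U = z\<^sup>\<alpha>\<close> and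
\<open>V = z\<^sup>\<beta>\<close>. Average \<open>(1 + \<rho> U) (1 + \<rho> V)\<close> with \<open>1 + \<i> \<rho>\<^sup>2 U V\<close> and with \<open>1 - \<i> \<rho>\<^sup>2 U V\<close>. The unknown
error is the same both times, so two polynomials \<open>1 + (\<rho>/2) (U + V) + p U V\<close> whose \<open>p\<close> differ by
\<open>\<i> \<rho>\<^sup>2\<close> would both be free of zeros. On \<open>U = V\<close> this is impossible, since absence of zeros forces
\<open>\<bar>Im p\<bar> < \<rho>\<^sup>2 / 2\<close>: see \<open>not_exhausted_of_balanced_split\<close>. Such \<open>\<alpha>\<close> and \<open>\<beta>\<close> exist whenever \<open>s \<ge> 2\<close>,
and also for \<open>s = 1\<close> and \<open>n = 2\<close>.

If \<open>s = 1\<close> and \<open>n \<ge> 3\<close>, take \<open>\<kappa> = n - 1\<close>. No coordinate has weight \<open>2 \<kappa>\<close>, so the part of \<open>D\<close> spanned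
by the last two coordinates would be convex. It contains all \<open>1 + b z ^ n\<close> with \<open>\<bar>b\<bar> < 1\<close>, whose
values at a point \<open>z\<close> of the circle fill the disc of radius \<open>1\<close> around \<open>1\<close>. Convexity and absence
of zeros then force every member to have nonnegative real part on the circle. But some trinomials
\<open>1 + a z ^ (n - 1) + b z ^ n\<close> without zeros have values with negative real part:
see \<open>not_exhausted_one_variable\<close>.\<close>

section \<open>Strict differentiability of holomorphic maps\<close>

lemma norm_vector_scalar_mult: "norm (z *s v) = cmod z * norm (v :: complex ^ 'n)"
  by (simp add: norm_vec_def norm_mult L2_set_right_distrib)

lemma bounded_linear_scalar_mult_left: "bounded_linear (\<lambda>z. z *s (v :: complex ^ 'n))"
  by (rule bounded_linear_intro[where K = "norm v"])
     (simp_all add: vec_eq_iff algebra_simps norm_vector_scalar_mult)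

lemma has_field_derivative_slice:
  fixes F :: "complex ^ 'n \<Rightarrow> complex"
  assumes "(F has_derivative L) (at (w + z *s e))" and "\<And>a v. L (a *s v) = a * L v"
  shows "((\<lambda>z. F (w + z *s e)) has_field_derivative L e) (at z)"
proof -
  have "((\<lambda>z. w + z *s e) has_derivative (\<lambda>d. 0 + d *s e)) (at z)"
    by (intro has_derivative_add has_derivative_const bounded_linear_imp_has_derivative
        bounded_linear_scalar_mult_left)
  then have "((\<lambda>z. F (w + z *s e)) has_derivative (\<lambda>d. L (0 + d *s e))) (at z)"
    using assms(1) by (rule has_derivative_compose)
  then show ?thesis
    by (simp add: has_field_derivative_def assms(2) mult_commute_abs)
qed

text \<open>Taylor's formula, with Cauchy's estimate for the second derivative on discs of radius \<open>R / 4\<close>.\<close>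

lemma second_order_bound_disc:
  assumes hol: "f holomorphic_on ball 0 R" and R: "0 < R"
    and bd: "\<And>z. z \<in> ball 0 R \<Longrightarrow> cmod (f z) \<le> B"
    and "f 0 = 0" "deriv f 0 = 0" and z: "cmod z < R / 4"
  shows "cmod (f z) \<le> 32 * B / R^2 * cmod z ^ 2"
proof -
  have c2: "cmod ((deriv ^^ 2) f w) \<le> 32 * B / R^2" if w: "w \<in> ball 0 (R/4)" for w
  proof -
    have sub: "cball w (R/4) \<subseteq> ball 0 R"
      using w R by (intro subsetI) (use norm_triangle_sub in \<open>simp add: dist_norm, smt (verit) norm_minus_commute norm_triangle_sub\<close>)
    have "cmod ((deriv ^^ 2) f w) \<le> fact 2 * B / (R/4) ^ 2"
    proof (rule Cauchy_inequality)
      show "f holomorphic_on ball w (R/4)"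
        using hol sub ball_subset_cball holomorphic_on_subset by blast
      show "continuous_on (cball w (R/4)) f"
        using hol sub holomorphic_on_imp_continuous_on continuous_on_subset by blast
      show "cmod (f x) \<le> B" if "cmod (w - x) = R/4" for x
        using that sub by (intro bd) (auto simp: dist_norm)
    qed (use R in auto)
    then show ?thesis by (simp add: power2_eq_square divide_simps)
  qed
  have "cmod (f z - (\<Sum>i\<le>1. (deriv ^^ i) f 0 * (z - 0) ^ i / fact i))
      \<le> (32 * B / R^2) * cmod (z - 0) ^ Suc 1 / fact 1"
  proof (rule complex_Taylor[where S = "ball 0 (R/4)" and f = "\<lambda>i. (deriv ^^ i) f", simplified funpow_0])
    fix i and x :: complex assume "x \<in> ball 0 (R/4)" "i \<le> (1::nat)"
    have "(deriv ^^ i) f holomorphic_on ball 0 (R/4)"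
      using R by (intro holomorphic_higher_deriv holomorphic_on_subset[OF hol]) auto
    then show "((deriv ^^ i) f has_field_derivative (deriv ^^ Suc i) f x) (at x within ball 0 (R/4))"
      using \<open>x \<in> ball 0 (R/4)\<close> holomorphic_derivI by fastforce
  qed (use c2 R z in \<open>auto simp: numeral_2_eq_2\<close>)
  then show ?thesis using assms(4,5) by (simp add: power2_eq_square)
qed

text \<open>The quadratic bound on the remainder \<open>\<phi>\<close> of the linear approximation at \<open>a\<close> holds on every complex
line through \<open>a\<close>, with a constant depending only on the radius of a ball
and a bound for \<open>\<phi>\<close> on it. Cauchy's estimate on discs of
radius comparable to the distance from \<open>a\<close> turns it into a linear bound on the derivative of \<open>\<phi>\<close>, and
the mean value inequality gives the claim. Only one-variable function theory is needed.\<close>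

lemma strict_differentiability_scalar:
  fixes F :: "complex ^ 'n \<Rightarrow> complex"
  assumes S: "open S" "a \<in> S"
    and der: "\<And>x. x \<in> S \<Longrightarrow> (F has_derivative F' x) (at x)"
    and lin: "\<And>x z v. x \<in> S \<Longrightarrow> F' x (z *s v) = z * F' x v"
  shows "\<exists>C r. 0 \<le> C \<and> 0 < r \<and> (\<forall>u v. norm u < r \<longrightarrow> norm v < r \<longrightarrow>
           cmod (F (a + u) - F (a + v) - F' a (u - v)) \<le> C * (norm u + norm v) * norm (u - v))"
proof -
  define \<phi> where "\<phi> = (\<lambda>w. F (a + w) - F a - F' a w)"
  have blin: "bounded_linear (F' x)" if "x \<in> S" for x
    using der[OF that] by (rule has_derivative_bounded_linear)
  obtain R0 where R0: "R0 > 0" "ball a R0 \<subseteq> S" using S openE by blast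
  define R where "R = R0 / 2"
  have R: "R > 0" and RS: "\<And>w. norm w \<le> R \<Longrightarrow> a + w \<in> S"
    using R0 by (auto simp: R_def dist_norm intro!: subsetD[OF R0(2)])
  have phi_der: "(\<phi> has_derivative (\<lambda>v. F' (a + w) v - F' a v)) (at w)" if "norm w \<le> R" for w
  proof -
    have "((\<lambda>w. a + w) has_derivative (\<lambda>v. v)) (at w)"
      by (auto intro!: derivative_eq_intros)
    from has_derivative_compose[OF this der[OF RS[OF that]]]
    have "((\<lambda>w. F (a + w)) has_derivative (\<lambda>v. F' (a + w) v)) (at w)" .
    then show ?thesis unfolding \<phi>_def
      using bounded_linear_imp_has_derivative[OF blin[OF S(2)]]
      by (auto intro!: derivative_eq_intros)
  qed
  have slice: "((\<lambda>z. \<phi> (w + z *s e)) has_field_derivative F' (a + (w + z *s e)) e - F' a e) (at z)"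
    if "norm (w + z *s e) \<le> R" for w e z
    using phi_der[OF that] lin[OF RS[OF that]] lin[OF S(2)]
    by (intro has_field_derivative_slice) (auto simp: algebra_simps)
  have "continuous_on (cball 0 R) \<phi>"
    by (intro continuous_at_imp_continuous_on ballI has_derivative_continuous[OF phi_der]) auto
  then have "bounded (\<phi> ` cball 0 R)"
    by (intro compact_imp_bounded compact_continuous_image) auto
  then obtain B where B: "B > 0" "\<And>w. norm w \<le> R \<Longrightarrow> cmod (\<phi> w) \<le> B"
    by (auto simp: bounded_pos)
  define C where "C = 32 * B / R^2"
  have C: "C \<ge> 0" using B R by (simp add: C_def)
  have quad: "cmod (\<phi> w) \<le> C * norm w ^ 2" if w: "norm w < R / 4" for w
  proof (cases "w = 0")
    case True then show ?thesis using blin[OF S(2)] by (simp add: \<phi>_def linear_simps)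
  next
    case False
    define e where "e = complex_of_real (1 / norm w) *s w"
    have e: "norm e = 1" using False by (simp add: e_def norm_vector_scalar_mult norm_divide)
    have we: "w = complex_of_real (norm w) *s e" using False by (simp add: e_def vec_eq_iff)
    let ?f = "\<lambda>z. \<phi> (0 + z *s e)"
    have ne: "norm (0 + z *s e) = cmod z" for z by (simp add: norm_vector_scalar_mult e)
    have fd: "(?f has_field_derivative F' (a + (0 + z *s e)) e - F' a e) (at z)" if "cmod z \<le> R" for z
      using slice[of 0 z e] that ne by simp
    have "cmod (?f (complex_of_real (norm w))) \<le> 32 * B / R^2 * cmod (complex_of_real (norm w)) ^ 2"
    proof (rule second_order_bound_disc[OF _ R])
      show "?f holomorphic_on ball 0 R"
        using fd by (meson holomorphic_onI field_differentiable_at_within field_differentiable_def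
            mem_ball_0 less_imp_le)
      show "cmod (?f z) \<le> B" if "z \<in> ball 0 R" for z using that ne[of z] by (intro B(2)) auto
      show "?f 0 = 0" using blin[OF S(2)] by (simp add: \<phi>_def linear_simps)
      show "deriv ?f 0 = 0" using DERIV_imp_deriv[OF fd[of 0]] R by simp
    qed (use w in auto)
    then show ?thesis using we by (simp add: C_def)
  qed
  define r where "r = R / 16"
  have main: "cmod (F (a + u) - F (a + v) - F' a (u - v)) \<le> (4 * C) * (norm u + norm v) * norm (u - v)"
    if u: "norm u < r" and v: "norm v < r" for u v
  proof (cases "u = v")
    case True then show ?thesis using blin[OF S(2)] by (simp add: linear_simps)
  next
    case False
    define p where "p = norm u + norm v"
    have p: "0 < p" using False by (cases "u = 0") (auto simp: p_def add_pos_nonneg)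
    have pr: "2 * p < R / 4" using u v by (simp add: p_def r_def)
    have "cmod (\<phi> u - \<phi> v) \<le> (4 * C * p) * norm (u - v)"
    proof (rule differentiable_bound)
      fix w assume "w \<in> cball (0 :: complex ^ 'n) p"
      then have w: "norm w \<le> p" by simp
      then have wR: "norm w \<le> R" using pr p by linarith
      show "(\<phi> has_derivative (\<lambda>v. F' (a + w) v - F' a v)) (at w within cball 0 p)"
        using phi_der[OF wR] by (rule has_derivative_at_withinI)
      show "onorm (\<lambda>v. F' (a + w) v - F' a v) \<le> 4 * C * p"
      proof (rule onorm_bound)
        fix h :: "complex ^ 'n"
        show "cmod (F' (a + w) h - F' a h) \<le> 4 * C * p * norm h"
        proof (cases "h = 0")
          case True
          then show ?thesis
            using blin[OF S(2)] blin[OF RS[OF wR]] by (simp add: linear_simps)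
        next
          case False
          define e where "e = complex_of_real (1 / norm h) *s h"
          have e: "norm e = 1" using False by (simp add: e_def norm_vector_scalar_mult norm_divide)
          have he: "h = complex_of_real (norm h) *s e" using False by (simp add: e_def vec_eq_iff)
          let ?f = "\<lambda>z. \<phi> (w + z *s e)"
          have nb: "norm (w + z *s e) \<le> 2 * p" if "cmod z \<le> p" for z
            using norm_triangle_ineq[of w "z *s e"] that w by (simp add: norm_vector_scalar_mult e)
          have fd: "(?f has_field_derivative F' (a + (w + z *s e)) e - F' a e) (at z)"
            if "cmod z \<le> p" for z
            using slice nb[OF that] pr R by auto
          have hol: "?f holomorphic_on cball 0 p"
            by (rule holomorphic_onI, rule field_differentiable_at_within)
               (use fd in \<open>auto simp: field_differentiable_def\<close>)
          \<comment> \<open>The radius \<open>p\<close> keeps the disc inside the ball of radius \<open>2 * p\<close>, where \<open>\<phi>\<close> is \<open>O(p\<^sup>2)\<close>.\<close>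
          have "cmod ((deriv ^^ 1) ?f 0) \<le> fact 1 * (C * (2 * p) ^ 2) / p ^ 1"
          proof (rule Cauchy_inequality)
            show "?f holomorphic_on ball 0 p" using hol ball_subset_cball holomorphic_on_subset by blast
            show "continuous_on (cball 0 p) ?f" using hol holomorphic_on_imp_continuous_on by blast
            show "cmod (?f z) \<le> C * (2 * p) ^ 2" if "cmod (0 - z) = p" for z
            proof -
              have n: "norm (w + z *s e) \<le> 2 * p" using nb that by simp
              then have "cmod (?f z) \<le> C * norm (w + z *s e) ^ 2" using pr by (intro quad) (rule le_less_trans)
              also have "\<dots> \<le> C * (2 * p) ^ 2" using n C by (intro mult_left_mono power_mono) auto
              finally show ?thesis .
            qed
          qed (use p in auto)
          moreover have "deriv ?f 0 = F' (a + w) e - F' a e"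
            using DERIV_imp_deriv[OF fd[of 0]] p by simp
          ultimately have "cmod (F' (a + w) e - F' a e) \<le> 4 * C * p"
            using p by (simp add: power2_eq_square)
          moreover have "F' (a + w) h - F' a h = complex_of_real (norm h) * (F' (a + w) e - F' a e)"
            by (subst (1 2) he) (simp add: lin[OF S(2)] lin[OF RS[OF wR]] algebra_simps)
          ultimately show ?thesis
            by (simp add: norm_mult mult.commute[of "norm h"] mult_right_mono)
        qed
      qed (use C p in auto)
    qed (use u v in \<open>auto simp: p_def\<close>)
    moreover have "\<phi> u - \<phi> v = F (a + u) - F (a + v) - F' a (u - v)"
      using blin[OF S(2)] by (simp add: \<phi>_def linear_simps)
    ultimately show ?thesis by (simp add: p_def)
  qed
  show ?thesis
    using main C R by (intro exI[of _ "4 * C"] exI[of _ r]) (auto simp: r_def)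
qed

section \<open>Orders of vanishing\<close>

definition vanishes_to_order :: "nat \<Rightarrow> (complex \<Rightarrow> 'a::real_normed_vector) \<Rightarrow> bool" where
  "vanishes_to_order p w \<longleftrightarrow> (\<exists>C. \<forall>\<^sub>F l in nhds 0. norm (w l) \<le> C * cmod l ^ p)"

lemma vanishes_to_order_add:
  assumes "vanishes_to_order p v" "vanishes_to_order p w"
  shows "vanishes_to_order p (\<lambda>l. v l + w l)"
proof -
  obtain C1 C2 where
    *: "\<forall>\<^sub>F l in nhds 0. norm (v l) \<le> C1 * cmod l ^ p" "\<forall>\<^sub>F l in nhds 0. norm (w l) \<le> C2 * cmod l ^ p"
    using assms by (auto simp: vanishes_to_order_def)
  have "\<forall>\<^sub>F l in nhds 0. norm (v l + w l) \<le> (C1 + C2) * cmod l ^ p"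
    using *
  proof eventually_elim
    case (elim l)
    then show ?case using norm_triangle_ineq[of "v l" "w l"] by (simp add: algebra_simps)
  qed
  then show ?thesis unfolding vanishes_to_order_def by blast
qed

lemma vanishes_to_order_bounded_linear:
  assumes "bounded_linear T" "vanishes_to_order p w"
  shows "vanishes_to_order p (\<lambda>l. T (w l))"
proof -
  obtain K where K: "K > 0" "\<And>x. norm (T x) \<le> norm x * K"
    using bounded_linear.pos_bounded[OF assms(1)] by blast
  obtain C where "\<forall>\<^sub>F l in nhds 0. norm (w l) \<le> C * cmod l ^ p"
    using assms by (auto simp: vanishes_to_order_def)
  then have "\<forall>\<^sub>F l in nhds 0. norm (T (w l)) \<le> (K * C) * cmod l ^ p"
  proof eventually_elim
    case (elim l)
    have "norm (T (w l)) \<le> norm (w l) * K" by (rule K)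
    also have "\<dots> \<le> (C * cmod l ^ p) * K" using elim K by (intro mult_right_mono) auto
    finally show ?case by (simp add: mult_ac)
  qed
  then show ?thesis unfolding vanishes_to_order_def by blast
qed

lemma vanishes_to_order_diff:
  assumes "vanishes_to_order p v" "vanishes_to_order p w"
  shows "vanishes_to_order p (\<lambda>l. v l - w l)"
  using vanishes_to_order_add[OF assms(1)
      vanishes_to_order_bounded_linear[OF bounded_linear_minus[OF bounded_linear_ident] assms(2)]]
  by simp

lemma vanishes_to_order_scaleR:
  "vanishes_to_order p w \<Longrightarrow> vanishes_to_order p (\<lambda>l. t *\<^sub>R w l)"
  by (rule vanishes_to_order_bounded_linear[OF bounded_linear_scaleR_right])

lemma vanishes_to_order_mono:
  assumes "vanishes_to_order p w" "q \<le> p"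
  shows "vanishes_to_order q w"
proof -
  obtain C where C: "\<forall>\<^sub>F l in nhds 0. norm (w l) \<le> C * cmod l ^ p"
    using assms by (auto simp: vanishes_to_order_def)
  have "\<forall>\<^sub>F l in nhds (0::complex). cmod l < 1"
    using eventually_nhds_in_open[of "ball 0 1" "0::complex"] by (auto elim: eventually_mono)
  with C have "\<forall>\<^sub>F l in nhds 0. norm (w l) \<le> \<bar>C\<bar> * cmod l ^ q"
  proof eventually_elim
    case (elim l)
    have "C * cmod l ^ p \<le> \<bar>C\<bar> * cmod l ^ p" by (intro mult_right_mono) auto
    also have "\<dots> \<le> \<bar>C\<bar> * cmod l ^ q"
      using elim assms(2) by (intro mult_left_mono power_decreasing) auto
    finally show ?case using elim by linarith
  qed
  then show ?thesis unfolding vanishes_to_order_def by blast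
qed

lemma vanishes_to_order_tendsto:
  assumes "vanishes_to_order p w" "1 \<le> p"
  shows "(w \<longlongrightarrow> 0) (nhds 0)"
proof -
  obtain C where C: "\<forall>\<^sub>F l in nhds 0. norm (w l) \<le> C * cmod l ^ p"
    using assms by (auto simp: vanishes_to_order_def)
  have "((\<lambda>l. C * cmod l ^ p) \<longlongrightarrow> C * cmod 0 ^ p) (nhds 0)"
    by (intro tendsto_intros filterlim_ident)
  then have "((\<lambda>l. C * cmod l ^ p) \<longlongrightarrow> 0) (nhds 0)" using assms(2) by (simp add: power_0_left)
  then show ?thesis by (rule Lim_null_comparison[OF C])
qed

text \<open>A quantitative form of strict differentiability, as holds for \<open>C\<^sup>2\<close> maps: the remainder has a Lipschitz
constant that shrinks linearly near \<open>a\<close>.\<close>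

definition strictly_differentiable_with ::
    "('a::real_normed_vector \<Rightarrow> 'b::real_normed_vector) \<Rightarrow> ('a \<Rightarrow> 'b) \<Rightarrow> 'a \<Rightarrow> bool" where
  "strictly_differentiable_with F L a \<longleftrightarrow> bounded_linear L \<and>
     (\<exists>C r. 0 \<le> C \<and> 0 < r \<and> (\<forall>u v. norm u < r \<longrightarrow> norm v < r \<longrightarrow>
        norm (F (a + u) - F (a + v) - L (u - v)) \<le> C * (norm u + norm v) * norm (u - v)))"

text \<open>The remainders along two curves agree to a higher order than the curves do. This is why a change of
the end points in coordinates of weight above \<open>\<kappa>\<close> does not affect the error term of order \<open>2 \<kappa>\<close>.\<close>

lemma vanishes_to_order_remainder_diff:
  assumes F: "strictly_differentiable_with F L a"
    and u: "vanishes_to_order p u" and v: "vanishes_to_order p v" "1 \<le> p"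
    and uv: "vanishes_to_order q (\<lambda>l. u l - v l)"
  shows "vanishes_to_order (p + q) (\<lambda>l. (F (a + u l) - F a - L (u l)) - (F (a + v l) - F a - L (v l)))"
proof -
  obtain C r where C: "C \<ge> 0" "r > 0"
    and *: "\<And>u v. norm u < r \<Longrightarrow> norm v < r \<Longrightarrow>
        norm (F (a + u) - F (a + v) - L (u - v)) \<le> C * (norm u + norm v) * norm (u - v)"
    using F unfolding strictly_differentiable_with_def by blast
  have L: "bounded_linear L" using F by (simp add: strictly_differentiable_with_def)
  obtain Cu Cv Cd where
    b: "\<forall>\<^sub>F l in nhds 0. norm (u l) \<le> Cu * cmod l ^ p" "\<forall>\<^sub>F l in nhds 0. norm (v l) \<le> Cv * cmod l ^ p"
       "\<forall>\<^sub>F l in nhds 0. norm (u l - v l) \<le> Cd * cmod l ^ q"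
    using u v uv unfolding vanishes_to_order_def by blast
  have s: "\<forall>\<^sub>F l in nhds 0. norm (u l) < r" "\<forall>\<^sub>F l in nhds 0. norm (v l) < r"
    using tendstoD[OF vanishes_to_order_tendsto[OF u v(2)] C(2)]
      tendstoD[OF vanishes_to_order_tendsto[OF v] C(2)] by (simp_all add: dist_norm)
  have "\<forall>\<^sub>F l in nhds 0. norm ((F (a + u l) - F a - L (u l)) - (F (a + v l) - F a - L (v l)))
          \<le> (C * (Cu + Cv) * Cd) * cmod l ^ (p + q)"
    using b s
  proof eventually_elim
    case (elim l)
    have "norm (F (a + u l) - F (a + v l) - L (u l - v l)) \<le> C * (norm (u l) + norm (v l)) * norm (u l - v l)"
      using elim by (intro *)
    also have "\<dots> \<le> C * (Cu * cmod l ^ p + Cv * cmod l ^ p) * (Cd * cmod l ^ q)"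
      using elim C by (intro mult_mono mult_left_mono add_mono mult_nonneg_nonneg)
        (auto intro: order_trans[OF norm_ge_zero] add_nonneg_nonneg)
    finally show ?case using L by (simp add: linear_simps power_add algebra_simps)
  qed
  then show ?thesis unfolding vanishes_to_order_def by blast
qed

lemma vanishes_to_order_remainder:
  assumes F: "strictly_differentiable_with F L a" and u: "vanishes_to_order p u" "1 \<le> p"
  shows "vanishes_to_order (2 * p) (\<lambda>l. F (a + u l) - F a - L (u l))"
proof -
  have "vanishes_to_order p (\<lambda>l. 0 :: 'a)"
    unfolding vanishes_to_order_def by (intro exI[of _ 0]) auto
  moreover have "bounded_linear L" using F by (simp add: strictly_differentiable_with_def)
  ultimately show ?thesis
    using vanishes_to_order_remainder_diff[OF F u(1) _ u(2), of "\<lambda>l. 0" p] u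
    by (simp add: linear_simps mult_2)
qed

lemma complex_linear_scale:
  assumes "Vector_Spaces.linear (*s) (*s) (T :: complex ^ 'n \<Rightarrow> complex ^ 'm)"
  shows "T (z *s v) = z *s T v"
  using assms by (simp add: Vector_Spaces.linear_def module_hom_def module_hom_axioms_def)

lemma norm_le_sum_components: "norm (x :: complex ^ 'n) \<le> (\<Sum>i\<in>UNIV. cmod (x $ i))"
  unfolding norm_vec_def by (rule L2_set_le_sum) simp

lemma strictly_differentiable_holomorphic_map:
  fixes F :: "complex ^ 'n \<Rightarrow> complex ^ 'm"
  assumes hol: "holomorphic_map_on F S" and S: "open S" "a \<in> S"
  obtains L where "strictly_differentiable_with F L a" "(F has_derivative L) (at a)"
proof -
  obtain F' where F': "\<And>x. x \<in> S \<Longrightarrow> (F has_derivative F' x) (at x)"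
      "\<And>x. x \<in> S \<Longrightarrow> Vector_Spaces.linear (*s) (*s) (F' x)"
    using hol unfolding holomorphic_map_on_def by metis
  have comp: "\<exists>C r. 0 \<le> C \<and> 0 < r \<and> (\<forall>u v. norm u < r \<longrightarrow> norm v < r \<longrightarrow>
      cmod (F (a + u) $ i - F (a + v) $ i - F' a (u - v) $ i) \<le> C * (norm u + norm v) * norm (u - v))" for i
  proof (rule strict_differentiability_scalar[OF S, where F = "\<lambda>x. F x $ i" and F' = "\<lambda>x v. F' x v $ i"])
    show "((\<lambda>x. F x $ i) has_derivative (\<lambda>v. F' x v $ i)) (at x)" if "x \<in> S" for x
      using bounded_linear.has_derivative[OF bounded_linear_vec_nth F'(1)[OF that]] .
    show "F' x (z *s v) $ i = z * F' x v $ i" if "x \<in> S" for x z v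
      using complex_linear_scale[OF F'(2)[OF that]] by simp
  qed
  then obtain C r where Cr: "\<And>i. 0 \<le> C i" "\<And>i. 0 < r i"
    "\<And>i u v. norm u < r i \<Longrightarrow> norm v < r i \<Longrightarrow>
      cmod (F (a + u) $ i - F (a + v) $ i - F' a (u - v) $ i) \<le> C i * (norm u + norm v) * norm (u - v)"
    by metis
  define \<rho> where "\<rho> = Min (range r)"
  have rho: "0 < \<rho>" "\<And>i. \<rho> \<le> r i" using Cr(2) by (auto simp: \<rho>_def)
  have "norm (F (a + u) - F (a + v) - F' a (u - v)) \<le> (\<Sum>i\<in>UNIV. C i) * (norm u + norm v) * norm (u - v)"
    if "norm u < \<rho>" "norm v < \<rho>" for u v
  proof -
    have "norm (F (a + u) - F (a + v) - F' a (u - v))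
        \<le> (\<Sum>i\<in>UNIV. cmod ((F (a + u) - F (a + v) - F' a (u - v)) $ i))" by (rule norm_le_sum_components)
    also have "\<dots> \<le> (\<Sum>i\<in>UNIV. C i * (norm u + norm v) * norm (u - v))"
      using that rho(2) by (intro sum_mono) (auto intro!: Cr(3) intro: less_le_trans)
    finally show ?thesis by (simp add: sum_distrib_right)
  qed
  moreover have "0 \<le> (\<Sum>i\<in>UNIV. C i)" using Cr by (intro sum_nonneg) auto
  moreover have "bounded_linear (F' a)" using F'(1)[OF S(2)] by (rule has_derivative_bounded_linear)
  ultimately have "strictly_differentiable_with F (F' a) a"
    using rho(1) unfolding strictly_differentiable_with_def by blast
  then show ?thesis using F'(1)[OF S(2)] that by blast
qed

section \<open>Convex combinations along weighted dilations\<close>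

definition dilate :: "('n \<Rightarrow> nat) \<Rightarrow> complex \<Rightarrow> complex ^ 'n \<Rightarrow> complex ^ 'n" where
  "dilate k l x = (\<chi> i. l ^ k i * x $ i)"

lemma dilate_add: "dilate k l (x + y) = dilate k l x + dilate k l y"
  and dilate_diff: "dilate k l (x - y) = dilate k l x - dilate k l y"
  and dilate_scaleR: "dilate k l (t *\<^sub>R x) = t *\<^sub>R dilate k l x"
  by (simp_all add: dilate_def vec_eq_iff algebra_simps)

lemma dilate_zero:
  assumes "\<And>i. 1 \<le> k i"
  shows "dilate k 0 x = 0"
proof -
  have "k i \<noteq> 0" for i using assms[of i] by linarith
  then show ?thesis by (simp only: dilate_def vec_eq_iff power_0_left) simp
qed

lemma continuous_dilate: "continuous_on A (\<lambda>l. dilate k l x)"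
  unfolding dilate_def by (intro continuous_intros)

lemma has_derivative_dilate:
  fixes x :: "complex ^ 'a"
  shows
  "((\<lambda>l. dilate k l x) has_derivative (\<lambda>d. d *s (\<chi> i. of_nat (k i) * l ^ (k i - 1) * x $ i))) (at l)"
proof -
  have sum_axis: "(\<Sum>i\<in>UNIV. z i *s axis i 1) = (\<chi> i. z i)" for z :: "'a \<Rightarrow> complex"
    by (simp add: vec_eq_iff axis_def if_distrib cong: if_cong)
  have "((\<lambda>l. l ^ k i * x $ i) has_derivative (\<lambda>d. d * (of_nat (k i) * l ^ (k i - 1) * x $ i))) (at l)" for i
    by (rule has_derivative_eq_rhs) (rule derivative_intros | simp add: fun_eq_iff algebra_simps)+
  then have "((\<lambda>l. \<Sum>i\<in>UNIV. (l ^ k i * x $ i) *s axis i 1) has_derivative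
     (\<lambda>d. \<Sum>i\<in>UNIV. (d * (of_nat (k i) * l ^ (k i - 1) * x $ i)) *s axis i 1)) (at l)"
    by (intro has_derivative_sum bounded_linear.has_derivative[OF bounded_linear_scalar_mult_left])
  then show ?thesis unfolding sum_axis by (simp add: dilate_def vector_scalar_mult_def)
qed

lemma vanishes_to_order_dilate:
  fixes x :: "complex ^ 'n"
  assumes "\<And>i. x $ i \<noteq> 0 \<Longrightarrow> p \<le> k i"
  shows "vanishes_to_order p (\<lambda>l. dilate k l x)"
proof -
  have "\<forall>\<^sub>F l in nhds (0::complex). cmod l < 1"
    using eventually_nhds_in_open[of "ball 0 1" "0::complex"] by (auto elim: eventually_mono)
  then have "\<forall>\<^sub>F l in nhds 0. norm (dilate k l x) \<le> (\<Sum>i\<in>UNIV. cmod (x $ i)) * cmod l ^ p"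
  proof eventually_elim
    case (elim l)
    have "norm (dilate k l x) \<le> (\<Sum>i\<in>UNIV. cmod (dilate k l x $ i))" by (rule norm_le_sum_components)
    also have "\<dots> \<le> (\<Sum>i\<in>UNIV. cmod (x $ i) * cmod l ^ p)"
    proof (rule sum_mono)
      fix i
      show "cmod (dilate k l x $ i) \<le> cmod (x $ i) * cmod l ^ p"
        using elim assms[of i]
        by (cases "x $ i = 0")
          (auto simp: dilate_def norm_mult norm_power mult.commute[of _ "cmod (x $ i)"]
            intro!: mult_left_mono power_decreasing)
    qed
    finally show ?case by (simp add: sum_distrib_right)
  qed
  then show ?thesis unfolding vanishes_to_order_def by blast
qed

lemma divide_out_zero:
  assumes hol: "H holomorphic_on U" and U: "open U" "0 \<in> U"
    and ord: "vanishes_to_order k H" and k: "1 \<le> k"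
  obtains \<psi> where "\<psi> holomorphic_on U" "\<And>l. l \<in> U \<Longrightarrow> H l = l ^ k * \<psi> l"
proof -
  obtain C where C: "\<forall>\<^sub>F l in nhds 0. cmod (H l) \<le> C * cmod l ^ k"
    using ord by (auto simp: vanishes_to_order_def)
  have "(\<lambda>l. H l / l ^ k) holomorphic_on (U - {0})"
    by (intro holomorphic_intros holomorphic_on_subset[OF hol]) auto
  moreover have "0 \<in> interior U" using U by (simp add: interior_open)
  moreover have "\<forall>\<^sub>F l in at 0. cmod (H l / l ^ k) \<le> C"
    using C unfolding eventually_at_filter
    by eventually_elim (auto simp: norm_divide norm_power divide_simps)
  ultimately obtain \<psi> where psi: "\<psi> holomorphic_on U" "\<forall>l\<in>U - {0}. \<psi> l = H l / l ^ k"
    using holomorphic_on_extend_bounded by blast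
  have "H 0 = 0" using eventually_nhds_x_imp_x[OF C] k by (simp add: power_0_left)
  then show ?thesis using psi k
    by (intro that[of \<psi>]) (simp, metis DiffI divide_eq_eq empty_iff insert_iff mult.commute
        mult_zero_left not_one_le_zero power_eq_0_iff zero_power zero_less_iff_neq_zero)
qed

lemma quotient_value_zero:
  assumes cont: "continuous (at 0) \<psi>" and ord: "vanishes_to_order (Suc k) (\<lambda>l. l ^ k * \<psi> l)"
  shows "\<psi> 0 = (0 :: complex)"
proof -
  obtain C where C: "\<forall>\<^sub>F l in nhds 0. cmod (l ^ k * \<psi> l) \<le> C * cmod l ^ Suc k"
    using ord by (auto simp: vanishes_to_order_def)
  have "\<forall>\<^sub>F l in at 0. cmod (\<psi> l) \<le> C * cmod l"
    using C unfolding eventually_at_filter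
    by eventually_elim (auto simp: norm_mult norm_power)
  moreover have "((\<lambda>l. C * cmod l) \<longlongrightarrow> C * cmod 0) (at 0)" by (intro tendsto_intros)
  ultimately have "(\<psi> \<longlongrightarrow> 0) (at 0)" by (auto intro: Lim_null_comparison)
  with cont show ?thesis by (metis LIM_unique continuous_at)
qed

text \<open>Both curves are \<open>h l = g ((1 - t) f (\<pi>\<^sub>l b) + t f (\<pi>\<^sub>l c))\<close> with \<open>g\<close> the inverse of \<open>f\<close>, divided by the
dilation \<open>\<pi>\<^sub>l\<close>. As \<open>\<pi>\<^sub>l b\<close> and \<open>\<pi>\<^sub>l c\<close> vanish to order \<open>\<kappa>\<close>, replacing \<open>f\<close> and \<open>g\<close> by their linear parts
costs \<open>O(l ^ (2 \<kappa>))\<close>, and the linear parts cancel. Hence \<open>h l = \<pi>\<^sub>l m + O(l ^ (2 \<kappa>))\<close>, so that the division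
leaves removable singularities. The quadratic terms depend on the coordinates of weight \<open>\<kappa>\<close> only, so
they drop out of the difference of the two curves up to order \<open>2 \<kappa> + 1\<close>.\<close>

lemma convex_combination_along_dilations:
  fixes E G :: "(complex ^ 'n) set"
  assumes E: "open E" and G: "open G" "convex G" and f: "biholomorphic_map f E G"
    and k: "\<And>i. 1 \<le> k i" "\<And>i. k i \<le> 2 * \<kappa>" and \<kappa>: "1 \<le> \<kappa>"
    and t: "0 \<le> t" "t \<le> (1::real)"
    and inE: "\<And>x l. x \<in> {b, c, b', c'} \<Longrightarrow> cmod l \<le> 1 \<Longrightarrow> dilate k l x \<in> E"
    and supp: "\<And>x i. x \<in> {b, c, b', c'} \<Longrightarrow> x $ i \<noteq> 0 \<Longrightarrow> \<kappa> \<le> k i"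
    and supp_diff: "\<And>i. b $ i \<noteq> b' $ i \<Longrightarrow> Suc \<kappa> \<le> k i" "\<And>i. c $ i \<noteq> c' $ i \<Longrightarrow> Suc \<kappa> \<le> k i"
  defines "m \<equiv> (1 - t) *\<^sub>R b + t *\<^sub>R c" and "m' \<equiv> (1 - t) *\<^sub>R b' + t *\<^sub>R c'"
  obtains U \<psi> \<psi>' where "open U" "cball 0 1 \<subseteq> U"
    "\<And>i. (\<lambda>l. \<psi> l $ i) holomorphic_on U" "\<And>i. (\<lambda>l. \<psi>' l $ i) holomorphic_on U"
    "\<And>l. l \<in> U \<Longrightarrow> dilate k l (\<psi> l) \<in> E" "\<And>l. l \<in> U \<Longrightarrow> dilate k l (\<psi>' l) \<in> E"
    "\<And>i. k i < 2 * \<kappa> \<Longrightarrow> \<psi> 0 $ i = m $ i" "\<psi> 0 - \<psi>' 0 = m - m'"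
proof -
  define g where "g = inv_into E f"
  have bij: "bij_betw f E G" and holf: "holomorphic_map_on f E" and holg: "holomorphic_map_on g G"
    using f by (auto simp: biholomorphic_map_def g_def)
  have fG: "f x \<in> G" and gf: "g (f x) = x" if "x \<in> E" for x
    using that bij by (auto simp: g_def bij_betw_def)
  have gE: "g u \<in> E" if "u \<in> G" for u
    using that bij by (metis g_def bij_betw_def inv_into_into)
  have E0: "0 \<in> E" using inE[of b 0] by (simp add: dilate_zero[OF k(1)])
  have f0: "f 0 \<in> G" using fG E0 .
  obtain L where L: "strictly_differentiable_with f L 0" "(f has_derivative L) (at 0)"
    using strictly_differentiable_holomorphic_map[OF holf E E0] .
  obtain M where M: "strictly_differentiable_with g M (f 0)" "(g has_derivative M) (at (f 0))"
    using strictly_differentiable_holomorphic_map[OF holg G(1) f0] .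
  have bl: "bounded_linear L" "bounded_linear M" using L(1) M(1) by (auto simp: strictly_differentiable_with_def)
  have M_L: "M (L v) = v" for v
  proof -
    have "((\<lambda>x. g (f x)) has_derivative (\<lambda>v. M (L v))) (at 0)"
      using has_derivative_compose[OF L(2) M(2)] .
    moreover have "((\<lambda>x. g (f x)) has_derivative (\<lambda>v. v)) (at 0)"
      by (rule has_derivative_transform_within_open[OF has_derivative_ident E E0]) (simp add: gf)
    ultimately show ?thesis using has_derivative_unique by metis
  qed
  define U where "U = (\<Inter>x\<in>{b, c, b', c'}. (\<lambda>l. dilate k l x) -` E)"
  have U: "open U" "cball 0 1 \<subseteq> U" "0 \<in> U"
    using inE continuous_dilate[of UNIV k] E
    by (auto simp: U_def open_vimage intro!: open_Int)
  have UE: "dilate k l x \<in> E" if "l \<in> U" "x \<in> {b, c, b', c'}" for l x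
    using that by (auto simp: U_def)
  define \<gamma> where "\<gamma> = (\<lambda>x y l. (1 - t) *\<^sub>R f (dilate k l x) + t *\<^sub>R f (dilate k l y))"
  define h where "h = (\<lambda>x y l. g (\<gamma> x y l))"
  define mid where "mid = (\<lambda>x y :: complex ^ 'n. (1 - t) *\<^sub>R x + t *\<^sub>R y)"
  define \<phi> where "\<phi> = (\<lambda>w. f (0 + w) - f 0 - L w)"
  define \<theta> where "\<theta> = (\<lambda>w. g (f 0 + w) - g (f 0) - M w)"
  define \<rho> where "\<rho> = (\<lambda>x y l. (1 - t) *\<^sub>R \<phi> (dilate k l x) + t *\<^sub>R \<phi> (dilate k l y))"
  define \<eta> where "\<eta> = (\<lambda>x y l. L (dilate k l (mid x y)) + \<rho> x y l)"
  have gam: "\<gamma> x y l = f 0 + \<eta> x y l" for x y l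
  proof -
    have "L (dilate k l (mid x y)) = (1 - t) *\<^sub>R L (dilate k l x) + t *\<^sub>R L (dilate k l y)"
      using bl(1) by (simp only: mid_def dilate_add dilate_scaleR linear_simps)
    then show ?thesis by (simp add: \<gamma>_def \<eta>_def \<rho>_def \<phi>_def algebra_simps)
  qed
  have h_eq: "h x y l - dilate k l (mid x y) = M (\<rho> x y l) + \<theta> (\<eta> x y l)" for x y l
    using bl(2) gf[OF E0] by (simp add: h_def gam \<theta>_def \<eta>_def linear_simps M_L)
  have gamG: "\<gamma> x y l \<in> G" if "l \<in> U" "x \<in> {b, c, b', c'}" "y \<in> {b, c, b', c'}" for x y l
    unfolding \<gamma>_def using t by (intro convexD[OF G(2)] fG UE that) auto
  have hE: "h x y l \<in> E" if "l \<in> U" "x \<in> {b, c, b', c'}" "y \<in> {b, c, b', c'}" for x y l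
    unfolding h_def by (intro gE gamG that)
  have h_hol: "(\<lambda>l. h x y l $ i) holomorphic_on U"
    if xy: "x \<in> {b, c, b', c'}" "y \<in> {b, c, b', c'}" for x y i
  proof (rule holomorphic_onI)
    fix l assume l: "l \<in> U"
    obtain Lx where Lx: "(f has_derivative Lx) (at (dilate k l x))" "Vector_Spaces.linear (*s) (*s) Lx"
      using holf UE[OF l xy(1)] by (auto simp: holomorphic_map_on_def)
    obtain Ly where Ly: "(f has_derivative Ly) (at (dilate k l y))" "Vector_Spaces.linear (*s) (*s) Ly"
      using holf UE[OF l xy(2)] by (auto simp: holomorphic_map_on_def)
    obtain N where N: "(g has_derivative N) (at (\<gamma> x y l))" "Vector_Spaces.linear (*s) (*s) N"
      using holg gamG[OF l xy] by (auto simp: holomorphic_map_on_def)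
    define dx where "dx = Lx (\<chi> i. of_nat (k i) * l ^ (k i - 1) * x $ i)"
    define dy where "dy = Ly (\<chi> i. of_nat (k i) * l ^ (k i - 1) * y $ i)"
    have "((\<lambda>l. f (dilate k l x)) has_derivative (\<lambda>d. d *s dx)) (at l)"
      using has_derivative_compose[OF has_derivative_dilate Lx(1)]
      by (simp add: dx_def complex_linear_scale[OF Lx(2)])
    moreover have "((\<lambda>l. f (dilate k l y)) has_derivative (\<lambda>d. d *s dy)) (at l)"
      using has_derivative_compose[OF has_derivative_dilate Ly(1)]
      by (simp add: dy_def complex_linear_scale[OF Ly(2)])
    ultimately have "((\<lambda>l. \<gamma> x y l) has_derivative (\<lambda>d. (1 - t) *\<^sub>R (d *s dx) + t *\<^sub>R (d *s dy))) (at l)"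
      unfolding \<gamma>_def by (intro has_derivative_add has_derivative_scaleR_right)
    also have "(\<lambda>d. (1 - t) *\<^sub>R (d *s dx) + t *\<^sub>R (d *s dy)) = (\<lambda>d. d *s ((1 - t) *\<^sub>R dx + t *\<^sub>R dy))"
      by (simp add: fun_eq_iff vec_eq_iff algebra_simps)
    finally have "((\<lambda>l. h x y l) has_derivative (\<lambda>d. N (d *s ((1 - t) *\<^sub>R dx + t *\<^sub>R dy)))) (at l)"
      
      unfolding h_def by (rule has_derivative_compose[where f = "\<gamma> x y", OF _ N(1)])
    then have "((\<lambda>l. h x y l $ i) has_derivative (\<lambda>d. N (d *s ((1 - t) *\<^sub>R dx + t *\<^sub>R dy)) $ i)) (at l)"
      by (rule bounded_linear.has_derivative[OF bounded_linear_vec_nth])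
    then have "((\<lambda>l. h x y l $ i) has_field_derivative N ((1 - t) *\<^sub>R dx + t *\<^sub>R dy) $ i) (at l)"
      by (simp only: has_field_derivative_def complex_linear_scale[OF N(2)] vector_smult_component
          mult_commute_abs)
    then show "(\<lambda>l. h x y l $ i) field_differentiable at l within U"
      by (meson field_differentiable_at_within field_differentiable_def)
  qed
  \<comment> \<open>Orders of vanishing, first of one curve, then of the difference of the two.\<close>
  have ord_dil: "vanishes_to_order \<kappa> (\<lambda>l. dilate k l x)" if "x \<in> {b, c, b', c'}" for x
    using supp[OF that] by (intro vanishes_to_order_dilate)
  have ord_mid: "vanishes_to_order \<kappa> (\<lambda>l. dilate k l (mid x y))"
    if "x \<in> {b, c, b', c'}" "y \<in> {b, c, b', c'}" for x y
    unfolding mid_def dilate_add dilate_scaleR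
    by (intro vanishes_to_order_add vanishes_to_order_scaleR ord_dil that)
  have ord_rho: "vanishes_to_order (2 * \<kappa>) (\<rho> x y)"
    if "x \<in> {b, c, b', c'}" "y \<in> {b, c, b', c'}" for x y
    unfolding \<rho>_def \<phi>_def
    by (intro vanishes_to_order_add vanishes_to_order_scaleR vanishes_to_order_remainder[OF L(1)] ord_dil \<kappa> that)
  have ord_eta: "vanishes_to_order \<kappa> (\<eta> x y)"
    if "x \<in> {b, c, b', c'}" "y \<in> {b, c, b', c'}" for x y
    unfolding \<eta>_def
    by (intro vanishes_to_order_add vanishes_to_order_bounded_linear[OF bl(1)] ord_mid
        vanishes_to_order_mono[OF ord_rho] that) simp
  have ord_h: "vanishes_to_order (2 * \<kappa>) (\<lambda>l. h x y l - dilate k l (mid x y))"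
    if "x \<in> {b, c, b', c'}" "y \<in> {b, c, b', c'}" for x y
    unfolding h_eq \<theta>_def
    by (intro vanishes_to_order_add vanishes_to_order_bounded_linear[OF bl(2)] ord_rho
        vanishes_to_order_remainder[OF M(1)] ord_eta \<kappa> that)
  have dil_diff: "vanishes_to_order (Suc \<kappa>) (\<lambda>l. dilate k l x - dilate k l y)"
    if "\<And>i. x $ i \<noteq> y $ i \<Longrightarrow> Suc \<kappa> \<le> k i" for x y :: "complex ^ 'n"
    unfolding dilate_diff[symmetric] by (rule vanishes_to_order_dilate) (use that in auto)
  have mid_diff: "vanishes_to_order (Suc \<kappa>) (\<lambda>l. dilate k l (mid b c) - dilate k l (mid b' c'))"
    by (rule dil_diff) (use supp_diff in \<open>auto simp: mid_def\<close>, metis)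
  have "vanishes_to_order (\<kappa> + Suc \<kappa>) (\<lambda>l. \<phi> (dilate k l b) - \<phi> (dilate k l b'))"
       "vanishes_to_order (\<kappa> + Suc \<kappa>) (\<lambda>l. \<phi> (dilate k l c) - \<phi> (dilate k l c'))"
    unfolding \<phi>_def
    by (rule vanishes_to_order_remainder_diff[OF L(1)]; (intro ord_dil dil_diff supp_diff \<kappa>; simp))+
  then have "vanishes_to_order (\<kappa> + Suc \<kappa>) (\<lambda>l. (1 - t) *\<^sub>R (\<phi> (dilate k l b) - \<phi> (dilate k l b'))
       + t *\<^sub>R (\<phi> (dilate k l c) - \<phi> (dilate k l c')))"
    by (intro vanishes_to_order_add vanishes_to_order_scaleR)
  then have rho_diff: "vanishes_to_order (\<kappa> + Suc \<kappa>) (\<lambda>l. \<rho> b c l - \<rho> b' c' l)"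
    by (simp add: \<rho>_def algebra_simps)
  have "vanishes_to_order (Suc \<kappa>) (\<lambda>l. L (dilate k l (mid b c) - dilate k l (mid b' c')) + (\<rho> b c l - \<rho> b' c' l))"
    by (intro vanishes_to_order_add vanishes_to_order_bounded_linear[OF bl(1)] mid_diff
        vanishes_to_order_mono[OF rho_diff]) simp
  then have eta_diff: "vanishes_to_order (Suc \<kappa>) (\<lambda>l. \<eta> b c l - \<eta> b' c' l)"
    using bl(1) by (simp add: \<eta>_def linear_simps algebra_simps)
  have "vanishes_to_order (\<kappa> + Suc \<kappa>) (\<lambda>l. M (\<rho> b c l - \<rho> b' c' l) + (\<theta> (\<eta> b c l) - \<theta> (\<eta> b' c' l)))"
    unfolding \<theta>_def
    by (intro vanishes_to_order_add vanishes_to_order_bounded_linear[OF bl(2)] rho_diff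
        vanishes_to_order_remainder_diff[OF M(1)] ord_eta eta_diff \<kappa>) simp_all
  then have h_diff: "vanishes_to_order (\<kappa> + Suc \<kappa>)
      (\<lambda>l. (h b c l - dilate k l (mid b c)) - (h b' c' l - dilate k l (mid b' c')))"
    unfolding h_eq using bl(2) by (simp add: linear_simps algebra_simps)
  \<comment> \<open>Removing the singularities at \<open>0\<close>, and comparing the values there.\<close>
  have quot: "\<exists>\<psi>. \<psi> holomorphic_on U \<and> (\<forall>l\<in>U. h x y l $ i = l ^ k i * \<psi> l)"
    if xy: "x \<in> {b, c, b', c'}" "y \<in> {b, c, b', c'}" for x y i
  proof -
    have "vanishes_to_order (k i) (\<lambda>l. (h x y l - dilate k l (mid x y)) $ i)"
      by (rule vanishes_to_order_bounded_linear[OF bounded_linear_vec_nth])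
         (rule vanishes_to_order_mono[OF ord_h[OF xy] k(2)])
    moreover have "vanishes_to_order (k i) (\<lambda>l. dilate k l (mid x y) $ i)"
      unfolding vanishes_to_order_def dilate_def
      by (intro exI[of _ "cmod (mid x y $ i)"]) (simp add: norm_mult norm_power)
    ultimately have "vanishes_to_order (k i) (\<lambda>l. h x y l $ i)"
      using vanishes_to_order_add by fastforce
    then show ?thesis using divide_out_zero[OF h_hol[OF xy] U(1) U(3) _ k(1)] by metis
  qed
  obtain \<psi>0 where psi0: "\<And>x y i. x \<in> {b, c, b', c'} \<Longrightarrow> y \<in> {b, c, b', c'} \<Longrightarrow> \<psi>0 x y i holomorphic_on U"
     "\<And>x y i l. x \<in> {b, c, b', c'} \<Longrightarrow> y \<in> {b, c, b', c'} \<Longrightarrow> l \<in> U \<Longrightarrow> h x y l $ i = l ^ k i * \<psi>0 x y i l"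
    using quot by metis
  have cont: "continuous (at 0) (\<psi>0 x y i)" if "x \<in> {b, c, b', c'}" "y \<in> {b, c, b', c'}" for x y i
    using psi0(1)[OF that] U by (metis continuous_on_eq_continuous_at holomorphic_on_imp_continuous_on)
  have evU: "\<forall>\<^sub>F l in nhds 0. l \<in> U" using U by (intro eventually_nhds_in_open)
  define \<psi> where "\<psi> = (\<lambda>x y l. \<chi> i. \<psi>0 x y i l)"
  have dil_psi: "dilate k l (\<psi> x y l) = h x y l"
    if "l \<in> U" "x \<in> {b, c, b', c'}" "y \<in> {b, c, b', c'}" for x y l
    using psi0(2) that by (simp add: dilate_def \<psi>_def vec_eq_iff)
  have cong: "vanishes_to_order p v \<longleftrightarrow> vanishes_to_order p w" if "\<And>l. l \<in> U \<Longrightarrow> v l = w l"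
    for p and v w :: "complex \<Rightarrow> complex"
    unfolding vanishes_to_order_def using evU that
    by (intro ex_cong1 eventually_cong[OF evU]) simp
  have val: "\<psi> b c 0 $ i = mid b c $ i" if "k i < 2 * \<kappa>" for i
  proof -
    have "vanishes_to_order (Suc (k i)) (\<lambda>l. (h b c l - dilate k l (mid b c)) $ i)"
      by (rule vanishes_to_order_bounded_linear[OF bounded_linear_vec_nth])
         (rule vanishes_to_order_mono[OF ord_h], use that in auto)
    then have "vanishes_to_order (Suc (k i)) (\<lambda>l. l ^ k i * (\<psi>0 b c i l - mid b c $ i))"
      by (subst (asm) cong) (auto simp: dilate_def psi0(2) algebra_simps)
    then have "\<psi>0 b c i 0 - mid b c $ i = 0"
      by (intro quotient_value_zero[where \<psi> = "\<lambda>l. \<psi>0 b c i l - mid b c $ i"]) (auto intro!: continuous_intros cont)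
    then show ?thesis by (simp add: \<psi>_def)
  qed
  have val_diff: "\<psi> b c 0 - \<psi> b' c' 0 = mid b c - mid b' c'"
  proof -
    have "\<psi>0 b c i 0 - mid b c $ i - (\<psi>0 b' c' i 0 - mid b' c' $ i) = 0" for i
    proof -
      let ?d = "\<lambda>l. \<psi>0 b c i l - mid b c $ i - (\<psi>0 b' c' i l - mid b' c' $ i)"
      have "vanishes_to_order (Suc (k i))
          (\<lambda>l. ((h b c l - dilate k l (mid b c)) - (h b' c' l - dilate k l (mid b' c'))) $ i)"
        by (rule vanishes_to_order_bounded_linear[OF bounded_linear_vec_nth])
           (rule vanishes_to_order_mono[OF h_diff], use k(2)[of i] in auto)
      then have "vanishes_to_order (Suc (k i)) (\<lambda>l. l ^ k i * ?d l)"
        by (subst (asm) cong) (auto simp: dilate_def psi0(2) algebra_simps)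
      then show ?thesis
        by (intro quotient_value_zero[where \<psi> = ?d]) (auto intro!: continuous_intros cont)
    qed
    then show ?thesis by (simp add: \<psi>_def vec_eq_iff algebra_simps)
  qed
  show ?thesis
  proof (rule that[of U "\<psi> b c" "\<psi> b' c'"])
    show "(\<lambda>l. \<psi> b c l $ i) holomorphic_on U" "(\<lambda>l. \<psi> b' c' l $ i) holomorphic_on U" for i
      using psi0(1) by (simp_all add: \<psi>_def)
    show "dilate k l (\<psi> b c l) \<in> E" "dilate k l (\<psi> b' c' l) \<in> E" if "l \<in> U" for l
      using dil_psi hE that by auto
    show "\<psi> b c 0 $ i = m $ i" if "k i < 2 * \<kappa>" for i using val[OF that] by (simp add: m_def mid_def)
    show "\<psi> b c 0 - \<psi> b' c' 0 = m - m'" using val_diff by (simp add: m_def m'_def mid_def)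
  qed (use U in auto)
qed

lemma compact_in_increasing_union:
  assumes "compact K" "K \<subseteq> (\<Union>j. E j)" "\<And>j. open (E j)" "\<And>j::nat. E j \<subseteq> E (Suc j)"
  shows "\<exists>j. K \<subseteq> E j"
proof -
  have mono: "E i \<subseteq> E j" if "i \<le> j" for i j using assms(4) that by (rule lift_Suc_mono_le)
  obtain I where I: "finite I" "K \<subseteq> (\<Union>j\<in>I. E j)"
    by (rule compactE_image[OF assms(1), of UNIV E]) (use assms in auto)
  have "E i \<subseteq> E (Max (insert 0 I))" if "i \<in> I" for i
    using that I(1) by (intro mono Max_ge) auto
  then have "K \<subseteq> E (Max (insert 0 I))" using I(2) by fast
  then show ?thesis ..
qed

text \<open>The dilates of the given points form a compact subset of \<open>D\<close>, hence lie in one of the exhausting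
domains. On the unit circle the dilation can be undone inside \<open>D\<close>, so that the disc property \<open>disc\<close>
carries the curves to points of \<open>D\<close>.\<close>

lemma exhausted_by_convex_combination:
  fixes D :: "(complex ^ 'n) set"
  assumes exh: "exhausted_by_convex D"
    and inv: "\<And>x l. x \<in> D \<Longrightarrow> cmod l \<le> 1 \<Longrightarrow> dilate k l x \<in> D"
    and disc: "\<And>U \<psi>. open U \<Longrightarrow> cball 0 1 \<subseteq> U \<Longrightarrow> (\<And>i. (\<lambda>l. \<psi> l $ i) holomorphic_on U) \<Longrightarrow>
        (\<And>l. cmod l = 1 \<Longrightarrow> \<psi> l \<in> D) \<Longrightarrow> \<psi> 0 \<in> D"
    and k: "\<And>i. 1 \<le> k i" "\<And>i. k i \<le> 2 * \<kappa>" and \<kappa>: "1 \<le> \<kappa>"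
    and t: "0 \<le> t" "t \<le> (1::real)"
    and inD: "b \<in> D" "c \<in> D" "b' \<in> D" "c' \<in> D"
    and supp: "\<And>x i. x \<in> {b, c, b', c'} \<Longrightarrow> x $ i \<noteq> 0 \<Longrightarrow> \<kappa> \<le> k i"
    and supp_diff: "\<And>i. b $ i \<noteq> b' $ i \<Longrightarrow> Suc \<kappa> \<le> k i" "\<And>i. c $ i \<noteq> c' $ i \<Longrightarrow> Suc \<kappa> \<le> k i"
  shows "\<exists>y. (\<forall>i. k i < 2 * \<kappa> \<longrightarrow> y $ i = 0) \<and>
    (1 - t) *\<^sub>R b + t *\<^sub>R c + y \<in> D \<and> (1 - t) *\<^sub>R b' + t *\<^sub>R c' + y \<in> D"
proof -
  obtain E where E: "\<And>j. domain_in (E j)" "\<And>j. biholomorphic_to_convex (E j)"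
      "\<And>j::nat. E j \<subseteq> E (Suc j)" "(\<Union>j. E j) = D"
    using exh by (auto simp: exhausted_by_convex_def)
  define K where "K = (\<Union>x\<in>{b, c, b', c'}. (\<lambda>l. dilate k l x) ` cball 0 1)"
  have "compact K" unfolding K_def
    by (intro compact_UN compact_continuous_image continuous_dilate) auto
  moreover have "K \<subseteq> D" using inv inD by (auto simp: K_def)
  ultimately obtain j where j: "K \<subseteq> E j"
    using compact_in_increasing_union[of K E] E by (auto simp: domain_in_def)
  obtain G :: "(complex ^ 'n) set" and f where G: "domain_in G" "convex G" "biholomorphic_map f (E j) G"
    using E(2)[of j] by (auto simp: biholomorphic_to_convex_def)
  have inE: "dilate k l x \<in> E j" if "x \<in> {b, c, b', c'}" "cmod l \<le> 1" for x l
    using that by (intro subsetD[OF j]) (auto simp: K_def)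
  have Ej: "open (E j)" and Go: "open G" using E(1)[of j] G(1) by (simp_all add: domain_in_def)
  obtain U \<psi> \<psi>' where U: "open U" "cball 0 1 \<subseteq> U"
    and hol: "\<And>i. (\<lambda>l. \<psi> l $ i) holomorphic_on U" "\<And>i. (\<lambda>l. \<psi>' l $ i) holomorphic_on U"
    and EE: "\<And>l. l \<in> U \<Longrightarrow> dilate k l (\<psi> l) \<in> E j" "\<And>l. l \<in> U \<Longrightarrow> dilate k l (\<psi>' l) \<in> E j"
    and val: "\<And>i. k i < 2 * \<kappa> \<Longrightarrow> \<psi> 0 $ i = ((1 - t) *\<^sub>R b + t *\<^sub>R c) $ i"
       "\<psi> 0 - \<psi>' 0 = (1 - t) *\<^sub>R b + t *\<^sub>R c - ((1 - t) *\<^sub>R b' + t *\<^sub>R c')"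
    apply (rule convex_combination_along_dilations[of "E j" G f k \<kappa> t b c b' c',
          OF Ej Go G(2,3) k \<kappa> t inE supp supp_diff, rotated -1])
    subgoal premises prems for U \<psi> \<psi>'
      by (rule prems(1); fact prems)
    by assumption+
  have circle: "x \<in> D" if "dilate k l x \<in> E j" "cmod l = 1" for l x
  proof -
    have "dilate k l x \<in> D" using that(1) E(4) by blast
    then have "dilate k (inverse l) (dilate k l x) \<in> D"
      by (rule inv) (simp add: norm_inverse that(2))
    moreover have "dilate k (inverse l) (dilate k l x) = x"
    proof -
      have "l \<noteq> 0" using that(2) by auto
      then show ?thesis by (simp add: dilate_def vec_eq_iff power_inverse)
    qed
    ultimately show ?thesis by simp
  qed
  have "\<psi> 0 \<in> D" "\<psi>' 0 \<in> D"
    using U(2) by (auto intro!: disc[OF U hol(1)] disc[OF U hol(2)] circle EE)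
  moreover have "\<psi>' 0 = (1 - t) *\<^sub>R b' + t *\<^sub>R c' + (\<psi> 0 - ((1 - t) *\<^sub>R b + t *\<^sub>R c))"
    using val(2) by (simp add: algebra_simps)
  ultimately show ?thesis
    using val(1) by (intro exI[of _ "\<psi> 0 - ((1 - t) *\<^sub>R b + t *\<^sub>R c)"]) auto
qed

section \<open>The disc property\<close>

text \<open>A form of Hurwitz's theorem. By the maximum principle for \<open>1 / P t\<close>, a function without zeros in
the disc is bounded below by the minimum \<open>M\<close> of \<open>\<bar>P\<bar>\<close> over all circles. So the set of parameters whose
function has no zeros is given by a closed condition, and it is also open.\<close>

lemma zero_free_homotopy:
  fixes P :: "real \<Rightarrow> complex \<Rightarrow> complex"
  assumes cont: "continuous_on ({0..1} \<times> cball 0 1) (\<lambda>(t, l). P t l)"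
    and hol: "\<And>t. t \<in> {0..1} \<Longrightarrow> P t holomorphic_on ball 0 1"
    and circle: "\<And>t l. t \<in> {0..1} \<Longrightarrow> cmod l = 1 \<Longrightarrow> P t l \<noteq> 0"
    and start: "\<And>l. cmod l \<le> 1 \<Longrightarrow> P 0 l \<noteq> 0"
    and l: "cmod l \<le> 1"
  shows "P 1 l \<noteq> 0"
proof -
  define T where "T = {t \<in> {0..1}. \<forall>l\<in>cball 0 1. P t l \<noteq> 0}"
  have contl: "continuous_on (cball 0 1) (P t)" if "t \<in> {0..1}" for t
  proof -
    have "continuous_on (cball 0 1) (\<lambda>l. case (t, l) of (t, l) \<Rightarrow> P t l)"
      by (rule continuous_on_compose2[OF cont]) (use that in \<open>auto intro!: continuous_intros\<close>)
    then show ?thesis by simp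
  qed
  have contt: "continuous_on {0..1} (\<lambda>t. P t l)" if "l \<in> cball 0 1" for l
  proof -
    have "continuous_on {0..1} (\<lambda>t. case (t, l) of (t, l) \<Rightarrow> P t l)"
      by (rule continuous_on_compose2[OF cont]) (use that in \<open>auto intro!: continuous_intros\<close>)
    then show ?thesis by simp
  qed
  have "continuous_on ({0..1} \<times> sphere 0 1) (\<lambda>p. cmod (case p of (t, l) \<Rightarrow> P t l))"
    by (intro continuous_on_norm continuous_on_subset[OF cont]) auto
  then obtain q where q: "q \<in> {0..1} \<times> sphere 0 1"
      "\<And>p. p \<in> {0..1} \<times> sphere 0 1 \<Longrightarrow> cmod (case q of (t, l) \<Rightarrow> P t l) \<le> cmod (case p of (t, l) \<Rightarrow> P t l)"
    by (rule continuous_attains_inf[rotated 2, elim_format]) (auto intro!: compact_Times exI[of _ 1])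
  define M where "M = cmod (case q of (t, l) \<Rightarrow> P t l)"
  have M: "M > 0" using q(1) circle by (auto simp: M_def split: prod.splits)
  have Mle: "M \<le> cmod (P t l)" if "t \<in> {0..1}" "cmod l = 1" for t l
    using q(2)[of "(t, l)"] that by (auto simp: M_def)
  have lower: "M \<le> cmod (P t l)" if t: "t \<in> T" and l: "l \<in> cball 0 1" for t l
  proof -
    have t01: "t \<in> {0..1}" and nz: "\<And>l. l \<in> cball 0 1 \<Longrightarrow> P t l \<noteq> 0" using t by (auto simp: T_def)
    have "cmod (inverse (P t l)) \<le> inverse M"
    proof (rule maximum_modulus_frontier[where S = "cball 0 1" and f = "\<lambda>l. inverse (P t l)"])
      show "(\<lambda>l. inverse (P t l)) holomorphic_on interior (cball 0 1)"
        using hol[OF t01] nz by (auto intro!: holomorphic_intros)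
      show "continuous_on (closure (cball 0 1)) (\<lambda>l. inverse (P t l))"
        using contl[OF t01] nz by (auto intro!: continuous_intros)
      show "cmod (inverse (P t l)) \<le> inverse M" if "l \<in> frontier (cball 0 1)" for l
        using Mle[OF t01, of l] that M by (auto simp: norm_inverse intro!: le_imp_inverse_le)
    qed (use l in auto)
    then show ?thesis using M nz[OF l] by (simp add: norm_inverse)
  qed
  have "T = (\<Inter>l\<in>cball 0 1. {t \<in> {0..1}. M \<le> cmod (P t l)})"
  proof (intro set_eqI iffI)
    fix t assume "t \<in> T"
    then show "t \<in> (\<Inter>l\<in>cball 0 1. {t \<in> {0..1}. M \<le> cmod (P t l)})"
      using lower by (auto simp: T_def)
  next
    fix t assume t: "t \<in> (\<Inter>l\<in>cball 0 1. {t \<in> {0..1}. M \<le> cmod (P t l)})"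
    have "t \<in> {0..1}" using INT_D[OF t, of 0] by auto
    moreover have "P t l \<noteq> 0" if "l \<in> cball 0 1" for l
      using INT_D[OF t that] M by auto
    ultimately show "t \<in> T" by (auto simp: T_def)
  qed
  moreover have "closed {t \<in> {0..1}. M \<le> cmod (P t l)}" if "l \<in> cball 0 1" for l
    by (intro continuous_on_closed_Collect_le continuous_intros contt that)
  ultimately have "closed T" by auto
  then have cl: "closedin (top_of_set {0..1}) T" by (auto simp: T_def intro: closed_subset)
  have "compact {p \<in> {0..1} \<times> cball 0 1. (case p of (t, l) \<Rightarrow> P t l) = 0}"
    using continuous_closedin_preimage_constant[OF cont, of 0]
    by (auto intro: closedin_compact[OF compact_Times[OF compact_Icc compact_cball]])
  then have "compact (fst ` {p \<in> {0..1} \<times> cball 0 1. (case p of (t, l) \<Rightarrow> P t l) = 0})"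
    by (intro compact_continuous_image continuous_intros)
  moreover have "fst ` {p \<in> {0..1} \<times> cball 0 1. (case p of (t, l) \<Rightarrow> P t l) = 0} = {0..1} - T"
    by (force simp: T_def)
  ultimately have "closedin (top_of_set {0..1}) ({0..1} - T)"
    by (auto intro: closed_subset compact_imp_closed)
  then have op: "openin (top_of_set {0..1}) T"
    by (auto simp: openin_closedin_eq T_def)
  have "0 \<in> T" using start by (simp add: T_def)
  then have "T = {0..1}"
    using cl op connected_Icc[of 0 "1::real"] unfolding connected_clopen by blast
  then have "(1::real) \<in> T" by simp
  then show ?thesis using l by (simp add: T_def)
qed

section \<open>The generalized tetrablock in terms of coefficients\<close>

definition coordinate_index :: "nat \<Rightarrow> (nat \<Rightarrow> nat) \<Rightarrow> (nat \<Rightarrow> 'n) \<Rightarrow> 'n \<Rightarrow> (nat \<Rightarrow> nat)" where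
  "coordinate_index s r c i = nth_index s r (inv_into {1..num_indices s r} c i)"

definition monomial_value :: "nat \<Rightarrow> (nat \<Rightarrow> nat) \<Rightarrow> (nat \<Rightarrow> complex) \<Rightarrow> complex" where
  "monomial_value s \<alpha> z = (\<Prod>j=1..s. z j ^ \<alpha> j)"

definition coeff_poly :: "nat \<Rightarrow> (nat \<Rightarrow> nat) \<Rightarrow> ((nat \<Rightarrow> nat) \<Rightarrow> complex) \<Rightarrow> (nat \<Rightarrow> complex) \<Rightarrow> complex" where
  "coeff_poly s r C z = 1 + (\<Sum>\<alpha>\<in>multi_indices s r. C \<alpha> * monomial_value s \<alpha> z)"

definition zero_free :: "nat \<Rightarrow> (nat \<Rightarrow> nat) \<Rightarrow> ((nat \<Rightarrow> nat) \<Rightarrow> complex) \<Rightarrow> bool" where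
  "zero_free s r C \<longleftrightarrow> (\<forall>z\<in>{1..s} \<rightarrow> cball 0 1. coeff_poly s r C z \<noteq> 0)"

text \<open>The factor \<open>(- 1) ^ \<bar>\<alpha>\<bar>\<close> makes \<open>C\<close> the family of coefficients of the polynomial that defines membership of
the point; see \<open>tetra_poly_coeff_point\<close>.\<close>

definition coeff_point :: "nat \<Rightarrow> (nat \<Rightarrow> nat) \<Rightarrow> (nat \<Rightarrow> 'n) \<Rightarrow> ((nat \<Rightarrow> nat) \<Rightarrow> complex) \<Rightarrow> complex ^ 'n" where
  "coeff_point s r c C =
     (\<chi> i. (- 1) ^ (\<Sum>j=1..s. coordinate_index s r c i j) * C (coordinate_index s r c i))"

definition weight :: "nat \<Rightarrow> (nat \<Rightarrow> nat) \<Rightarrow> (nat \<Rightarrow> nat) \<Rightarrow> nat" where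
  "weight s m \<alpha> = (\<Sum>j=1..s. m j * \<alpha> j)"

lemma sign_mult_self [simp]: "(- 1) ^ d * ((- 1) ^ d * (x :: complex)) = x"
  by (simp add: mult.assoc[symmetric] power_mult_distrib[symmetric])

lemma multi_indicesI:
  assumes "\<alpha> \<in> (\<Pi>\<^sub>E j\<in>{1..s}. {0..r j})" "j \<in> {1..s}" "\<alpha> j \<noteq> 0"
  shows "\<alpha> \<in> multi_indices s r"
  using assms by (auto simp: multi_indices_def)

lemma multi_index_nonzero:
  assumes "\<alpha> \<in> multi_indices s r"
  obtains j where "j \<in> {1..s}" "\<alpha> j \<noteq> 0"
proof -
  have "\<exists>j\<in>{1..s}. \<alpha> j \<noteq> 0"
  proof (rule ccontr)
    assume *: "\<not> ?thesis"
    have "\<alpha> = (\<lambda>j\<in>{1..s}. 0)"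
    proof (rule extensionalityI)
      show "\<alpha> \<in> extensional {1..s}" using assms by (simp add: multi_indices_def PiE_def)
    qed (use * in auto)
    then show False using assms by (simp add: multi_indices_def)
  qed
  then show ?thesis using that by blast
qed

context
  fixes s :: nat and r :: "nat \<Rightarrow> nat" and c :: "nat \<Rightarrow> 'n::finite"
  assumes c: "bij_betw c {1..num_indices s r} (UNIV :: 'n set)"
begin

lemma coordinate_index_bij: "bij_betw (coordinate_index s r c) UNIV (multi_indices s r)"
  using bij_betw_trans[OF bij_betw_inv_into[OF c] nth_index_bij[of s r]]
  by (simp add: comp_def coordinate_index_def[abs_def])

lemma tetra_poly_coordinates:
  "tetra_poly s r c x z = 1 + (\<Sum>i\<in>UNIV. (- 1) ^ (\<Sum>j=1..s. coordinate_index s r c i j) * x $ i *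
     monomial_value s (coordinate_index s r c i) z)"
proof -
  have "(\<Sum>i\<in>UNIV. (- 1) ^ (\<Sum>j=1..s. coordinate_index s r c i j) * x $ i * monomial_value s (coordinate_index s r c i) z)
    = (\<Sum>k\<in>{1..num_indices s r}. (- 1) ^ (\<Sum>j=1..s. coordinate_index s r c (c k) j) * x $ (c k) *
        monomial_value s (coordinate_index s r c (c k)) z)"
    by (rule sum.reindex_bij_betw[OF c, symmetric])
  also have "\<dots> = (\<Sum>k\<in>{1..num_indices s r}. (- 1) ^ (\<Sum>j=1..s. nth_index s r k j) * x $ c k *
      (\<Prod>j=1..s. z j ^ nth_index s r k j))"
    using c by (intro sum.cong)
      (auto simp: coordinate_index_def monomial_value_def bij_betw_def inv_into_f_f)
  finally show ?thesis by (simp add: tetra_poly_def)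
qed

lemma tetra_poly_coeff_point: "tetra_poly s r c (coeff_point s r c C) z = coeff_poly s r C z"
  unfolding tetra_poly_coordinates coeff_poly_def coeff_point_def
  using sum.reindex_bij_betw[OF coordinate_index_bij, of "\<lambda>\<alpha>. C \<alpha> * monomial_value s \<alpha> z"]
  by simp

lemma coeff_point_mem_iff: "coeff_point s r c C \<in> gen_tetrablock s r c \<longleftrightarrow> zero_free s r C"
  by (simp add: gen_tetrablock_def zero_free_def tetra_poly_coeff_point)

lemma coeff_point_surj: "\<exists>C. coeff_point s r c C = x"
proof
  let ?f = "coordinate_index s r c"
  have "inv_into UNIV ?f (?f i) = i" for i
    using coordinate_index_bij by (simp add: bij_betw_def)
  then show "coeff_point s r c (\<lambda>\<alpha>. (- 1) ^ (\<Sum>j=1..s. \<alpha> j) * x $ inv_into UNIV ?f \<alpha>) = x"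
    by (simp add: coeff_point_def vec_eq_iff)
qed

lemma tetra_poly_dilate:
  "tetra_poly s r c (dilate (\<lambda>i. weight s m (coordinate_index s r c i)) l x) z
    = tetra_poly s r c x (\<lambda>j. l ^ m j * z j)"
proof -
  have "monomial_value s \<alpha> (\<lambda>j. l ^ m j * z j) = l ^ weight s m \<alpha> * monomial_value s \<alpha> z" for \<alpha>
    by (simp add: monomial_value_def weight_def power_mult_distrib prod.distrib power_sum power_mult)
  then show ?thesis by (simp add: tetra_poly_coordinates dilate_def mult_ac)
qed

lemma gen_tetrablock_dilate:
  assumes "x \<in> gen_tetrablock s r c" "cmod l \<le> 1"
  shows "dilate (\<lambda>i. weight s m (coordinate_index s r c i)) l x \<in> gen_tetrablock s r c"
  unfolding gen_tetrablock_def mem_Collect_eq tetra_poly_dilate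
proof
  fix z :: "nat \<Rightarrow> complex" assume z: "z \<in> {1..s} \<rightarrow> cball 0 1"
  have "(\<lambda>j. l ^ m j * z j) \<in> {1..s} \<rightarrow> cball 0 1"
    using z assms(2) by (auto simp: Pi_iff norm_mult norm_power intro!: mult_le_one power_le_one)
  then show "tetra_poly s r c x (\<lambda>j. l ^ m j * z j) \<noteq> 0"
    using assms(1) by (auto simp: gen_tetrablock_def)
qed

text \<open>Shrinking the argument \<open>z\<close> to \<open>0\<close> deforms the function \<open>l \<mapsto> R (\<psi> l) z\<close> to the constant \<open>1\<close>, without
creating zeros on the unit circle.\<close>

lemma gen_tetrablock_disc:
  assumes U: "open U" "cball 0 1 \<subseteq> U" and hol: "\<And>i. (\<lambda>l. \<psi> l $ i) holomorphic_on U"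
    and circle: "\<And>l. cmod l = 1 \<Longrightarrow> \<psi> l \<in> gen_tetrablock s r c"
  shows "\<psi> 0 \<in> gen_tetrablock s r c"
  unfolding gen_tetrablock_def mem_Collect_eq
proof
  fix z :: "nat \<Rightarrow> complex" assume z: "z \<in> {1..s} \<rightarrow> cball 0 1"
  define P where "P = (\<lambda>t l. tetra_poly s r c (\<psi> l) (\<lambda>j. complex_of_real t * z j))"
  have "P 1 0 \<noteq> 0"
  proof (rule zero_free_homotopy[where P = P and l = 0])
    have comp: "continuous_on ({0..1} \<times> cball 0 1) (\<lambda>p :: real \<times> complex. \<psi> (snd p) $ i)" for i
      by (rule continuous_on_compose2[OF holomorphic_on_imp_continuous_on[OF hol]])
         (use U in \<open>auto intro!: continuous_intros\<close>)
    have "continuous_on ({0..1} \<times> cball 0 1) (\<lambda>p. P (fst p) (snd p))"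
      unfolding P_def tetra_poly_def 
      by (intro comp continuous_on_add continuous_on_sum continuous_on_mult continuous_on_prod
          continuous_on_power continuous_on_const continuous_on_of_real continuous_on_fst continuous_on_id)
    then show "continuous_on ({0..1} \<times> cball 0 1) (\<lambda>(t, l). P t l)"
      by (simp add: case_prod_beta)
    show "P t holomorphic_on ball 0 1" for t
    proof -
      have "ball 0 1 \<subseteq> U" using U(2) ball_subset_cball by blast
      then show ?thesis unfolding P_def tetra_poly_def
        by (intro holomorphic_intros holomorphic_on_subset[OF hol])
    qed
    show "P t l \<noteq> 0" if "t \<in> {0..1}" "cmod l = 1" for t l
    proof -
      have "(\<lambda>j. complex_of_real t * z j) \<in> {1..s} \<rightarrow> cball 0 1"
        using z that(1) by (auto simp: Pi_iff norm_mult intro!: mult_le_one)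
      then show ?thesis using circle[OF that(2)] by (auto simp: gen_tetrablock_def P_def)
    qed
    show "P 0 l \<noteq> 0" for l
    proof -
      have van: "(\<Prod>j=1..s. (0::complex) ^ nth_index s r k j) = 0" if k: "k \<in> {1..num_indices s r}" for k
      proof -
        let ?\<alpha> = "nth_index s r k"
        have "?\<alpha> \<in> multi_indices s r" using nth_index_bij k by (rule bij_betwE[rule_format])
        then obtain j where "j \<in> {1..s}" "?\<alpha> j \<noteq> 0" by (rule multi_index_nonzero)
        then show ?thesis by auto
      qed
      have "(\<Sum>k=1..num_indices s r. (- 1) ^ (\<Sum>j=1..s. nth_index s r k j) * \<psi> l $ c k *
          (\<Prod>j=1..s. (0::complex) ^ nth_index s r k j)) = 0"
        by (intro sum.neutral ballI) (simp only: van mult_zero_right)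
      then show ?thesis by (simp add: P_def tetra_poly_def)
    qed
  qed simp
  then show "tetra_poly s r c (\<psi> 0) z \<noteq> 0" by (simp add: P_def)
qed

text \<open>The tetrablock is nearly convex in the coordinates of large weight. The error \<open>Y\<close> lives in the
coordinates of weight \<open>2 \<kappa>\<close> and is common to the two pairs \<open>A, B\<close> and \<open>A', B'\<close>, which may differ in
coordinates of weight above \<open>\<kappa>\<close>.\<close>

lemma gen_tetrablock_convex_combination:
  assumes exh: "exhausted_by_convex (gen_tetrablock s r c)"
    and m: "\<And>j. j \<in> {1..s} \<Longrightarrow> 1 \<le> m j"
    and \<kappa>: "1 \<le> \<kappa>" "\<And>\<alpha>. \<alpha> \<in> multi_indices s r \<Longrightarrow> weight s m \<alpha> \<le> 2 * \<kappa>"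
    and t: "0 \<le> t" "t \<le> (1::real)"
    and zf: "zero_free s r A" "zero_free s r B" "zero_free s r A'" "zero_free s r B'"
    and supp: "\<And>\<alpha>. \<alpha> \<in> multi_indices s r \<Longrightarrow> weight s m \<alpha> < \<kappa> \<Longrightarrow>
       A \<alpha> = 0 \<and> B \<alpha> = 0 \<and> A' \<alpha> = 0 \<and> B' \<alpha> = 0"
    and supp_diff: "\<And>\<alpha>. \<alpha> \<in> multi_indices s r \<Longrightarrow> weight s m \<alpha> \<le> \<kappa> \<Longrightarrow> A \<alpha> = A' \<alpha> \<and> B \<alpha> = B' \<alpha>"
  shows "\<exists>Y. (\<forall>\<alpha>\<in>multi_indices s r. weight s m \<alpha> < 2 * \<kappa> \<longrightarrow> Y \<alpha> = 0) \<and>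
    zero_free s r (\<lambda>\<alpha>. of_real (1 - t) * A \<alpha> + of_real t * B \<alpha> + Y \<alpha>) \<and>
    zero_free s r (\<lambda>\<alpha>. of_real (1 - t) * A' \<alpha> + of_real t * B' \<alpha> + Y \<alpha>)"
proof -
  let ?p = "coeff_point s r c" and ?f = "coordinate_index s r c"
  let ?k = "\<lambda>i. weight s m (?f i)"
  have f_mem: "?f i \<in> multi_indices s r" for i
    using coordinate_index_bij by (auto simp: bij_betw_def)
  have k1: "1 \<le> ?k i" for i
  proof -
    obtain j where j: "j \<in> {1..s}" "?f i j \<noteq> 0" using f_mem[of i] by (rule multi_index_nonzero)
    then have "m j * ?f i j \<noteq> 0" using m[OF j(1)] by simp
    then have "?k i \<noteq> 0" using j(1) by (auto simp: weight_def)
    then show ?thesis by simp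
  qed
  have nz: "?p C $ i \<noteq> 0 \<longleftrightarrow> C (?f i) \<noteq> 0" for C i by (simp add: coeff_point_def)
  have neq: "?p C $ i \<noteq> ?p C' $ i \<longleftrightarrow> C (?f i) \<noteq> C' (?f i)" for C C' i by (simp add: coeff_point_def)
  have comb: "(1 - t) *\<^sub>R ?p C + t *\<^sub>R ?p C' + ?p Y =
      ?p (\<lambda>\<alpha>. of_real (1 - t) * C \<alpha> + of_real t * C' \<alpha> + Y \<alpha>)" for C C' Y
    by (simp add: coeff_point_def vec_eq_iff)
       (simp add: scaleR_conv_of_real[where 'a = complex] algebra_simps)
  have supp': "\<kappa> \<le> ?k i" if "x \<in> {?p A, ?p B, ?p A', ?p B'}" "x $ i \<noteq> 0" for x i
    using that supp[OF f_mem[of i]] nz by (auto simp: not_less[symmetric])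
  have supp_diff': "Suc \<kappa> \<le> ?k i" if "?p A $ i \<noteq> ?p A' $ i \<or> ?p B $ i \<noteq> ?p B' $ i" for i
    using that supp_diff[OF f_mem[of i]] neq by (auto simp: Suc_le_eq not_le[symmetric])
  have ps: "?p A \<in> gen_tetrablock s r c" "?p B \<in> gen_tetrablock s r c"
      "?p A' \<in> gen_tetrablock s r c" "?p B' \<in> gen_tetrablock s r c"
    using zf by (simp_all add: coeff_point_mem_iff)
  have "\<exists>y. (\<forall>i. ?k i < 2 * \<kappa> \<longrightarrow> y $ i = 0) \<and>
      (1 - t) *\<^sub>R ?p A + t *\<^sub>R ?p B + y \<in> gen_tetrablock s r c \<and>
      (1 - t) *\<^sub>R ?p A' + t *\<^sub>R ?p B' + y \<in> gen_tetrablock s r c"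
  proof (rule exhausted_by_convex_combination[OF exh])
    show "\<psi> 0 \<in> gen_tetrablock s r c"
      if "open U" "cball 0 1 \<subseteq> U" "\<And>i. (\<lambda>l. \<psi> l $ i) holomorphic_on U"
        "\<And>l. cmod l = 1 \<Longrightarrow> \<psi> l \<in> gen_tetrablock s r c" for U and \<psi> :: "complex \<Rightarrow> complex ^ 'n"
      using gen_tetrablock_disc that by blast
    show "?k i \<le> 2 * \<kappa>" for i using \<kappa>(2)[OF f_mem] .
    show "\<kappa> \<le> ?k i" if "x \<in> {?p A, ?p B, ?p A', ?p B'}" "x $ i \<noteq> 0" for x i
      using supp' that .
  qed (use gen_tetrablock_dilate k1 \<kappa>(1) t ps supp_diff' in blast)+
  then obtain y where y: "\<And>i. ?k i < 2 * \<kappa> \<Longrightarrow> y $ i = 0"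
      "(1 - t) *\<^sub>R ?p A + t *\<^sub>R ?p B + y \<in> gen_tetrablock s r c"
      "(1 - t) *\<^sub>R ?p A' + t *\<^sub>R ?p B' + y \<in> gen_tetrablock s r c"
    by blast
  obtain Y where Y: "?p Y = y" using coeff_point_surj by blast
  have Y0: "Y \<alpha> = 0" if "\<alpha> \<in> multi_indices s r" "weight s m \<alpha> < 2 * \<kappa>" for \<alpha>
  proof -
    have "\<alpha> \<in> range ?f"
      using that(1) by (simp only: bij_betw_imp_surj_on[OF coordinate_index_bij])
    then obtain i where "\<alpha> = ?f i" ..
    then show ?thesis using y(1)[of i] that(2) nz[of Y i] Y by auto
  qed
  show ?thesis
    using Y0 y(2,3)[folded Y, unfolded comb coeff_point_mem_iff] by blast
qed

end

section \<open>Balanced splittings\<close>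

text \<open>Here \<open>9/10\<close> is a round number below the minimum, which is about \<open>0.95\<close> and attained near \<open>x = 2/5\<close>.\<close>

lemma sum_squares_lower_bound:
  fixes x y :: real
  assumes "0 \<le> x" "1 / 16 \<le> x^2 * y^2"
  shows "9 / 10 \<le> x^2 + x + y^2"
proof -
  have "x \<noteq> 0" using assms(2) by auto
  then have x: "0 < x^2" by simp
  have "0 \<le> (x^2 - 2/5 * x)^2 + ((x - 2/5)^2 * (9/5 * x + 19/50) + 2/125 * x + 17/10000)"
    using assms(1) by (intro add_nonneg_nonneg mult_nonneg_nonneg) auto
  also have "\<dots> = x^2 * (x^2 + x - 9/10) + 1/16"
    by (simp add: power2_eq_square algebra_simps)
  also have "\<dots> \<le> x^2 * (x^2 + x + y^2 - 9/10)"
    using assms(2) by (simp add: algebra_simps)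
  finally show ?thesis using x by (simp add: zero_le_mult_iff)
qed

text \<open>If \<open>d\<^sup>2\<close> is a quarter of the discriminant of \<open>w\<^sup>2 + \<rho> w + p\<close>, then \<open>\<bar>Im d\<^sup>2\<bar> = \<bar>Im p\<bar>\<close> is large, so \<open>d\<close> is far
from \<open>0\<close>, and the root \<open>- \<rho>/2 - d\<close> with \<open>Re d \<ge> 0\<close> has modulus at least \<open>1\<close>. Its inverse is the root
required. The value of \<open>\<rho>\<close> need only satisfy \<open>(1/4 + 9/10) \<rho>\<^sup>2 \<ge> 1\<close> and \<open>\<rho> < 1\<close>.\<close>

lemma quadratic_root_in_disc:
  assumes \<rho>: "\<rho> = 19 / 20" and p: "\<rho>^2 / 2 \<le> \<bar>Im p\<bar>"
  obtains \<zeta> where "cmod \<zeta> \<le> 1" "1 + of_real \<rho> * \<zeta> + p * \<zeta>^2 = 0"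
proof -
  define d where "d = csqrt (of_real (\<rho>^2 / 4) - p)"
  define w where "w = - (of_real (\<rho> / 2) + d)"
  have d2: "d^2 = of_real (\<rho>^2 / 4) - p" by (simp add: d_def)
  have "2 * (Re d * Im d) = - Im p"
    using arg_cong[OF d2, of Im] by (simp add: power2_eq_square mult.commute)
  then have "\<rho>^2 / 4 \<le> \<bar>Re d * Im d\<bar>" using p by linarith
  then have "(\<rho>^2 / 4)^2 \<le> (Re d * Im d)^2" by (subst abs_le_square_iff[symmetric]) simp
  then have "1 / 16 \<le> (Re d / \<rho>)^2 * (Im d / \<rho>)^2"
    by (simp add: \<rho> power_divide power_mult_distrib field_simps)
  moreover have "0 \<le> Re d" unfolding d_def using csqrt_principal[of "of_real (\<rho>^2 / 4) - p"] by linarith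
  then have "0 \<le> Re d / \<rho>" by (simp add: \<rho>)
  ultimately have "9 / 10 \<le> (Re d / \<rho>)^2 + Re d / \<rho> + (Im d / \<rho>)^2"
    by (rule sum_squares_lower_bound[rotated])
  then have "1 \<le> (\<rho> / 2 + Re d)^2 + (Im d)^2"
    by (simp add: \<rho> power2_eq_square field_simps)
  also have "\<dots> = (cmod w)^2" unfolding cmod_power2 by (simp add: w_def power2_eq_square algebra_simps)
  finally have w: "1 \<le> cmod w" using power2_le_imp_le[of 1 "cmod w"] by simp
  then have w0: "w \<noteq> 0" by auto
  have "w^2 + of_real \<rho> * w + p = d^2 - of_real (\<rho>^2 / 4) + p"
    by (simp add: w_def power2_eq_square field_simps)
  then have "w^2 + of_real \<rho> * w + p = 0" using d2 by simp
  moreover have "1 + of_real \<rho> * inverse w + p * (inverse w)^2 = (w^2 + of_real \<rho> * w + p) / w^2"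
    using w0 by (simp add: field_simps power2_eq_square)
  moreover have "cmod (inverse w) \<le> 1" using w by (simp add: norm_inverse inverse_le_1_iff)
  ultimately show ?thesis using that by auto
qed

lemma one_plus_nonzero: "cmod w < 1 \<Longrightarrow> 1 + w \<noteq> 0"
  by (metis add_eq_0_iff norm_minus_cancel norm_one less_irrefl)

lemma norm_monomial_value_le_1:
  assumes "z \<in> {1..s} \<rightarrow> cball 0 1"
  shows "cmod (monomial_value s \<alpha> z) \<le> 1"
  unfolding monomial_value_def prod_norm[symmetric]
  using assms by (intro prod_le_1) (auto simp: norm_power Pi_iff intro!: power_le_one)

text \<open>With \<open>U = z\<^sup>\<alpha>\<close> and \<open>V = z\<^sup>\<beta>\<close>, the polynomials \<open>(1 + \<rho> U) (1 + \<rho> V)\<close> and \<open>1 \<plusminus> \<i> \<rho>\<^sup>2 U V\<close> have no zeros. The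
index \<open>r\<close> of the coefficient of \<open>U V\<close> is the only one of weight \<open>2 \<kappa>\<close>, so both midpoints are polynomials
\<open>1 + (\<rho>/2) (U + V) + p U V\<close>, with the same unknown summand in \<open>p\<close>. The two values of \<open>p\<close> differ by \<open>\<i> \<rho>\<^sup>2\<close>,
so for one of them the quadratic obtained by setting \<open>U = V\<close> has a root in the disc.\<close>

lemma not_exhausted_of_balanced_split:
  fixes c :: "nat \<Rightarrow> 'n::finite"
  assumes c: "bij_betw c {1..num_indices s r} (UNIV :: 'n set)"
    and m: "\<And>j. j \<in> {1..s} \<Longrightarrow> 1 \<le> m j"
    and mi: "\<alpha> \<in> multi_indices s r" "\<beta> \<in> multi_indices s r"
    and split: "\<And>j. j \<in> {1..s} \<Longrightarrow> \<alpha> j + \<beta> j = r j"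
    and bal: "weight s m \<alpha> = weight s m \<beta>"
    and hit: "\<And>\<zeta>. cmod \<zeta> \<le> 1 \<Longrightarrow>
        \<exists>z\<in>{1..s} \<rightarrow> cball 0 1. monomial_value s \<alpha> z = \<zeta> \<and> monomial_value s \<beta> z = \<zeta>"
  shows "\<not> exhausted_by_convex (gen_tetrablock s r c)"
proof
  assume exh: "exhausted_by_convex (gen_tetrablock s r c)"
  define \<tau> where "\<tau> = (\<lambda>j\<in>{1..s}. r j)"
  define \<kappa> where "\<kappa> = weight s m \<alpha>"
  define \<rho> :: real where "\<rho> = 19 / 20"
  define M where "M = multi_indices s r"
  have finM: "finite M" by (simp add: M_def finite_multi_indices)
  have le_r: "\<gamma> j \<le> r j" if "\<gamma> \<in> M" "j \<in> {1..s}" for \<gamma> j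
    using that by (auto simp: M_def multi_indices_def PiE_iff)
  have ext: "\<gamma> \<in> extensional {1..s}" if "\<gamma> \<in> M" for \<gamma>
    using that by (auto simp: M_def multi_indices_def PiE_iff)
  obtain j0 where j0: "j0 \<in> {1..s}" "\<alpha> j0 \<noteq> 0" using mi(1) by (rule multi_index_nonzero)
  have "r j0 \<noteq> 0" using j0 split[OF j0(1)] by linarith
  then have "\<tau> \<noteq> (\<lambda>j\<in>{1..s}. 0)" using j0(1) by (metis \<tau>_def restrict_apply')
  then have tauM: "\<tau> \<in> M" by (auto simp: M_def multi_indices_def \<tau>_def)
  have w_tau: "weight s m \<tau> = 2 * \<kappa>"
  proof -
    have "weight s m \<tau> = (\<Sum>j=1..s. m j * \<alpha> j + m j * \<beta> j)"
      unfolding weight_def using split by (intro sum.cong) (auto simp: \<tau>_def algebra_simps[symmetric] simp flip: split)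
    also have "\<dots> = weight s m \<alpha> + weight s m \<beta>" by (simp add: weight_def sum.distrib)
    finally show ?thesis using bal by (simp add: \<kappa>_def)
  qed
  have w_less: "weight s m \<gamma> < 2 * \<kappa>" if \<gamma>: "\<gamma> \<in> M" "\<gamma> \<noteq> \<tau>" for \<gamma>
  proof -
    have "\<exists>j\<in>{1..s}. \<gamma> j \<noteq> r j"
    proof (rule ccontr)
      assume *: "\<not> ?thesis"
      have "\<gamma> = \<tau>"
        by (rule extensionalityI[OF ext[OF \<gamma>(1)]]) (use * in \<open>auto simp: \<tau>_def\<close>)
      then show False using \<gamma>(2) by simp
    qed
    then obtain j where j: "j \<in> {1..s}" "\<gamma> j < r j"
      using le_r[OF \<gamma>(1)] by (metis le_neq_implies_less)
    have "weight s m \<gamma> < weight s m \<tau>"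
      unfolding weight_def
    proof (rule sum_strict_mono_ex1)
      show "\<forall>j\<in>{1..s}. m j * \<gamma> j \<le> m j * \<tau> j" using le_r[OF \<gamma>(1)] by (simp add: \<tau>_def)
      show "\<exists>j\<in>{1..s}. m j * \<gamma> j < m j * \<tau> j" using j m[OF j(1)] by (intro bexI[of _ j]) (auto simp: \<tau>_def)
    qed simp
    then show ?thesis using w_tau by simp
  qed
  have w_le: "weight s m \<gamma> \<le> 2 * \<kappa>" if "\<gamma> \<in> M" for \<gamma>
    using w_less[OF that] w_tau by (cases "\<gamma> = \<tau>") auto
  have "m j0 * \<alpha> j0 \<noteq> 0" using j0 m[OF j0(1)] by simp
  then have "\<kappa> \<noteq> 0" using j0(1) by (auto simp: \<kappa>_def weight_def)
  then have \<kappa>: "1 \<le> \<kappa>" by simp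
  have ne: "\<alpha> \<noteq> \<tau>" "\<beta> \<noteq> \<tau>" using w_tau bal \<kappa> by (auto simp: \<kappa>_def)
  have mon_tau: "monomial_value s \<tau> z = monomial_value s \<alpha> z * monomial_value s \<beta> z" for z
    by (simp add: monomial_value_def \<tau>_def flip: prod.distrib power_add split)
  define C where "C = (\<lambda>(a::complex) (p::complex) \<gamma>. (if \<gamma> = \<alpha> then a / 2 else 0) +
     (if \<gamma> = \<beta> then a / 2 else 0) + (if \<gamma> = \<tau> then p else 0))"
  have poly: "coeff_poly s r (C a p) z = 1 + a / 2 * (monomial_value s \<alpha> z + monomial_value s \<beta> z)
      + p * (monomial_value s \<alpha> z * monomial_value s \<beta> z)" for a p z
  proof -
    have "(\<Sum>\<gamma>\<in>M. C a p \<gamma> * monomial_value s \<gamma> z)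
      = (\<Sum>\<gamma>\<in>M. (if \<gamma> = \<alpha> then a / 2 * monomial_value s \<gamma> z else 0)
         + (if \<gamma> = \<beta> then a / 2 * monomial_value s \<gamma> z else 0)
         + (if \<gamma> = \<tau> then p * monomial_value s \<gamma> z else 0))"
      by (intro sum.cong) (auto simp: C_def algebra_simps)
    also have "\<dots> = a / 2 * monomial_value s \<alpha> z + a / 2 * monomial_value s \<beta> z + p * monomial_value s \<tau> z"
      using finM mi tauM by (simp add: sum.distrib M_def)
    finally show ?thesis by (simp add: coeff_poly_def M_def mon_tau algebra_simps)
  qed
  \<comment> \<open>The coefficients of \<open>(1 + \<rho> U) (1 + \<rho> V)\<close>.\<close>
  have zf1: "zero_free s r (C (2 * of_real \<rho>) (of_real (\<rho>^2)))"
    unfolding zero_free_def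
  proof
    fix z :: "nat \<Rightarrow> complex" assume z: "z \<in> {1..s} \<rightarrow> cball 0 1"
    have "1 + of_real \<rho> * monomial_value s \<gamma> z \<noteq> 0" for \<gamma>
    proof (rule one_plus_nonzero)
      show "cmod (of_real \<rho> * monomial_value s \<gamma> z) < 1"
        using norm_monomial_value_le_1[OF z, of \<gamma>] by (simp add: norm_mult \<rho>_def)
    qed
    moreover have "coeff_poly s r (C (2 * of_real \<rho>) (of_real (\<rho>^2))) z =
        (1 + of_real \<rho> * monomial_value s \<alpha> z) * (1 + of_real \<rho> * monomial_value s \<beta> z)"
      by (simp add: poly power2_eq_square algebra_simps)
    ultimately show "coeff_poly s r (C (2 * of_real \<rho>) (of_real (\<rho>^2))) z \<noteq> 0" by simp
  qed
  have zf2: "zero_free s r (C 0 (e * of_real (\<rho>^2)))" if e: "cmod e = 1" for e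
    unfolding zero_free_def
  proof
    fix z :: "nat \<Rightarrow> complex" assume z: "z \<in> {1..s} \<rightarrow> cball 0 1"
    have "cmod (e * of_real (\<rho>^2) * (monomial_value s \<alpha> z * monomial_value s \<beta> z)) =
        \<rho>^2 * cmod (monomial_value s \<tau> z)" by (simp add: norm_mult e mon_tau norm_power)
    also have "\<dots> < 1" using norm_monomial_value_le_1[OF z, of \<tau>] by (simp add: \<rho>_def power2_eq_square)
    finally show "coeff_poly s r (C 0 (e * of_real (\<rho>^2))) z \<noteq> 0"
      unfolding poly using one_plus_nonzero by simp
  qed
  have w_half: "\<gamma> \<noteq> \<tau>" if "weight s m \<gamma> \<le> \<kappa>" for \<gamma> using that w_tau \<kappa> by auto
  have Cnz: "C a p \<gamma> = 0" if "weight s m \<gamma> < \<kappa>" for a p \<gamma>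
    using that bal w_half[of \<gamma>] by (auto simp: C_def \<kappa>_def)
  have "\<exists>Y. (\<forall>\<gamma>\<in>multi_indices s r. weight s m \<gamma> < 2 * \<kappa> \<longrightarrow> Y \<gamma> = 0) \<and>
      zero_free s r (\<lambda>\<gamma>. of_real (1 - 1/2) * C (2 * of_real \<rho>) (of_real (\<rho>^2)) \<gamma> +
        of_real (1/2) * C 0 (\<i> * of_real (\<rho>^2)) \<gamma> + Y \<gamma>) \<and>
      zero_free s r (\<lambda>\<gamma>. of_real (1 - 1/2) * C (2 * of_real \<rho>) (of_real (\<rho>^2)) \<gamma> +
        of_real (1/2) * C 0 (- \<i> * of_real (\<rho>^2)) \<gamma> + Y \<gamma>)"
  proof (rule gen_tetrablock_convex_combination[OF c exh m \<kappa>])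
    show "C (2 * of_real \<rho>) (of_real (\<rho>^2)) \<gamma> = C (2 * of_real \<rho>) (of_real (\<rho>^2)) \<gamma> \<and>
       C 0 (\<i> * of_real (\<rho>^2)) \<gamma> = C 0 (- \<i> * of_real (\<rho>^2)) \<gamma>"
      if "weight s m \<gamma> \<le> \<kappa>" for \<gamma> using w_half[OF that] by (simp add: C_def)
    show "zero_free s r (C 0 (\<i> * of_real (\<rho>^2)))" "zero_free s r (C 0 (- \<i> * of_real (\<rho>^2)))"
      by (intro zf2; simp)+
  qed (use w_le zf1 Cnz in \<open>auto simp: M_def\<close>)
  then obtain Y where Y0: "\<And>\<gamma>. \<gamma> \<in> multi_indices s r \<Longrightarrow> weight s m \<gamma> < 2 * \<kappa> \<Longrightarrow> Y \<gamma> = 0"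
    and Y: "zero_free s r (\<lambda>\<gamma>. of_real (1 - 1/2) * C (2 * of_real \<rho>) (of_real (\<rho>^2)) \<gamma> +
        of_real (1/2) * C 0 (\<i> * of_real (\<rho>^2)) \<gamma> + Y \<gamma>)"
      "zero_free s r (\<lambda>\<gamma>. of_real (1 - 1/2) * C (2 * of_real \<rho>) (of_real (\<rho>^2)) \<gamma> +
        of_real (1/2) * C 0 (- \<i> * of_real (\<rho>^2)) \<gamma> + Y \<gamma>)"
    by blast
  have no_root: "\<bar>Im (of_real (\<rho>^2) * (1 + e) / 2 + Y \<tau>)\<bar> < \<rho>^2 / 2"
    if zf: "zero_free s r (\<lambda>\<gamma>. of_real (1 - 1/2) * C (2 * of_real \<rho>) (of_real (\<rho>^2)) \<gamma> +
        of_real (1/2) * C 0 (e * of_real (\<rho>^2)) \<gamma> + Y \<gamma>)" for e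
  proof (rule ccontr)
    let ?p = "of_real (\<rho>^2) * (1 + e) / 2 + Y \<tau>"
    assume "\<not> \<bar>Im ?p\<bar> < \<rho>^2 / 2"
    then have "\<rho>^2 / 2 \<le> \<bar>Im ?p\<bar>" by simp
    then obtain \<zeta> where \<zeta>: "cmod \<zeta> \<le> 1" "1 + of_real \<rho> * \<zeta> + ?p * \<zeta>^2 = 0"
      by (rule quadratic_root_in_disc[OF \<rho>_def])
    obtain z where z: "z \<in> {1..s} \<rightarrow> cball 0 1" "monomial_value s \<alpha> z = \<zeta>" "monomial_value s \<beta> z = \<zeta>"
      using hit[OF \<zeta>(1)] by blast
    have "coeff_poly s r (\<lambda>\<gamma>. of_real (1 - 1/2) * C (2 * of_real \<rho>) (of_real (\<rho>^2)) \<gamma> +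
        of_real (1/2) * C 0 (e * of_real (\<rho>^2)) \<gamma> + Y \<gamma>) z
      = coeff_poly s r (C (of_real \<rho>) ?p) z"
    proof -
      have "of_real (1 - 1/2) * C (2 * of_real \<rho>) (of_real (\<rho>^2)) \<gamma> +
          of_real (1/2) * C 0 (e * of_real (\<rho>^2)) \<gamma> + Y \<gamma> = C (of_real \<rho>) ?p \<gamma>" if "\<gamma> \<in> M" for \<gamma>
        using Y0[of \<gamma>] w_less[OF that] that ne by (auto simp: C_def M_def field_simps)
      then show ?thesis by (simp add: coeff_poly_def M_def)
    qed
    also have "\<dots> = 0" using \<zeta>(2) by (simp add: poly z power2_eq_square algebra_simps)
    finally show False using zf z(1) by (auto simp: zero_free_def)
  qed
  show False using no_root[OF Y(1)] no_root[OF Y(2)] unfolding abs_less_iff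
    by (simp add: \<rho>_def power2_eq_square)
qed

section \<open>One variable and degree at least three\<close>

lemma norm_one_minus_power_le:
  assumes "cmod z \<le> 1"
  shows "cmod (1 - z ^ k) \<le> of_nat k * cmod (1 - z)"
proof -
  have "cmod (\<Sum>i<k. z ^ i) \<le> (\<Sum>i<k. 1)"
    using assms by (intro sum_norm_le) (simp add: norm_power power_le_one)
  then have "cmod (1 - z) * cmod (\<Sum>i<k. z ^ i) \<le> cmod (1 - z) * of_nat k"
    by (intro mult_left_mono) auto
  then show ?thesis by (simp add: one_diff_power_eq norm_mult mult.commute)
qed

text \<open>The polynomial is \<open>(1 - z) g z\<close> with \<open>g\<close> a small perturbation of \<open>1 + z + \<dots> + z ^ (p - 2)\<close>, whose zeros lie on
the unit circle. At a zero, \<open>\<bar>1 - \<epsilon> (1 - z)\<bar> \<ge> 1\<close>. The direction of \<open>\<epsilon>\<close> is so close to the positive axis that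
this makes \<open>1 - z\<close> almost imaginary, hence small because \<open>\<bar>z\<bar> < 1\<close>. But \<open>g\<close> has no zero near \<open>1\<close>.\<close>

lemma trinomial_zero_free:
  fixes \<delta> :: real and p :: nat
  assumes p: "2 \<le> p" and \<delta>: "0 < \<delta>" "\<delta> * (8 * p) \<le> 1" and z: "cmod z < 1"
  defines "\<epsilon> \<equiv> Complex \<delta> (\<delta>^2)"
  shows "1 - (1 - \<epsilon>) * z ^ (p - 1) - \<epsilon> * z ^ p \<noteq> 0"
proof
  assume root: "1 - (1 - \<epsilon>) * z ^ (p - 1) - \<epsilon> * z ^ p = 0"
  define v where "v = 1 - z"
  define x where "x = Re v"
  define y where "y = Im v"
  have d16: "\<delta> \<le> 1 / 16"
  proof -
    have "\<delta> * 16 \<le> \<delta> * (8 * p)" using p \<delta>(1) by (intro mult_left_mono) auto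
    then show ?thesis using \<delta>(2) by simp
  qed
  have zp: "z ^ p = z * z ^ (p - 1)" using p by (simp flip: power_Suc)
  have norm_v: "(cmod v)^2 = x^2 + y^2" by (simp add: cmod_power2 x_def y_def)
  have "(cmod z)^2 < 1" using z by (simp add: power_less_one_iff abs_square_less_1)
  then have "(Re z)^2 + (Im z)^2 < 1" by (simp only: cmod_power2)
  then have xy: "x^2 + y^2 < 2 * x"
    by (simp add: x_def y_def v_def power2_eq_square algebra_simps)
  have x: "0 < x" using xy zero_le_power2[of x] zero_le_power2[of y] by linarith
  have "z ^ (p - 1) * (1 - \<epsilon> * v) = 1" using root by (simp add: zp v_def algebra_simps)
  then have "cmod (z ^ (p - 1)) * cmod (1 - \<epsilon> * v) = 1" by (metis norm_mult norm_one)
  moreover have "cmod (z ^ (p - 1)) \<le> 1" using z by (simp add: norm_power power_le_one)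
  ultimately have "1 \<le> cmod (1 - \<epsilon> * v)"
    by (metis mult_left_le_one_le norm_ge_zero)
  then have "1 \<le> (cmod (1 - \<epsilon> * v))^2" by simp
  also have "\<dots> = 1 - 2 * Re (\<epsilon> * v) + (cmod \<epsilon>)^2 * (cmod v)^2"
    by (simp only: cmod_power2) (simp add: power2_eq_square algebra_simps)
  also have "\<dots> \<le> 1 - 2 * (\<delta> * x - \<delta>^2 * y) + (2 * \<delta>^2) * (2 * x)"
  proof -
    have "\<delta>^2 * \<delta>^2 \<le> \<delta>^2 * 1" using d16 \<delta>(1) by (intro mult_left_mono) (auto intro: power_le_one)
    then have "(cmod \<epsilon>)^2 \<le> 2 * \<delta>^2" by (simp add: cmod_power2 \<epsilon>_def power2_eq_square[of "\<delta>^2"])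
    then have "(cmod \<epsilon>)^2 * (cmod v)^2 \<le> (2 * \<delta>^2) * (2 * x)"
      using xy by (intro mult_mono) (auto simp: norm_v)
    then show ?thesis by (simp add: \<epsilon>_def x_def y_def)
  qed
  finally have "\<delta> * (x - \<delta> * y - 2 * \<delta> * x) \<le> 0" by (simp add: power2_eq_square algebra_simps)
  then have "x - \<delta> * y - 2 * \<delta> * x \<le> 0" using \<delta>(1) by (simp add: mult_le_0_iff)
  moreover have "\<delta> * x \<le> 1 / 16 * x" using d16 x by (intro mult_right_mono) auto
  ultimately have x2y: "x \<le> 2 * (\<delta> * y)" using x by linarith
  have y: "0 < y" using x2y x \<delta>(1) by (smt (verit) mult_nonneg_nonpos)
  have "y^2 < 4 * (\<delta> * y)" using xy x2y zero_le_power2[of x] by linarith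
  then have "y * y < (4 * \<delta>) * y" by (simp add: power2_eq_square mult_ac)
  then have y4: "y < 4 * \<delta>" using y by simp
  have "(cmod v)^2 < 4 * \<delta> * y" using xy x2y norm_v by linarith
  also have "\<dots> \<le> 4 * \<delta> * (4 * \<delta>)" using y4 \<delta>(1) by (intro mult_left_mono) auto
  finally have "(cmod v)^2 < (4 * \<delta>)^2" by (simp add: power2_eq_square)
  then have v4: "cmod v < 4 * \<delta>" by (rule power2_less_imp_less) (use \<delta>(1) in simp)
  define g where "g = (\<Sum>k<p - 1. z ^ k) + \<epsilon> * z ^ (p - 1)"
  have "v * g = 1 - (1 - \<epsilon>) * z ^ (p - 1) - \<epsilon> * z ^ p"
    using one_diff_power_eq[of z "p - 1"] by (simp add: g_def v_def zp algebra_simps)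
  moreover have "v \<noteq> 0" using x by (auto simp: x_def)
  ultimately have "g = 0" using root by simp
  moreover have "(\<Sum>k<p - 1. 1 - z ^ k) - \<epsilon> * z ^ (p - 1) = of_nat (p - 1) - g"
    by (simp add: g_def sum_subtractf)
  ultimately have eq: "of_nat (p - 1) = (\<Sum>k<p - 1. 1 - z ^ k) - \<epsilon> * z ^ (p - 1)" by simp
  have "real (p - 1) = cmod ((\<Sum>k<p - 1. 1 - z ^ k) - \<epsilon> * z ^ (p - 1))"
    unfolding eq[symmetric] by simp
  also have "\<dots> \<le> (\<Sum>k<p - 1. cmod (1 - z ^ k)) + cmod (\<epsilon> * z ^ (p - 1))"
    by (intro order_trans[OF norm_triangle_ineq4] add_mono norm_sum) auto
  also have "\<dots> \<le> (\<Sum>k<p - 1. 1 / 2) + 1 / 4"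
  proof (intro add_mono sum_mono)
    fix k assume k: "k \<in> {..<p - 1}"
    have "cmod (1 - z ^ k) \<le> of_nat k * cmod v" using norm_one_minus_power_le z by (simp add: v_def)
    also have "\<dots> \<le> of_nat p * (4 * \<delta>)" using k v4 by (intro mult_mono) auto
    finally show "cmod (1 - z ^ k) \<le> 1 / 2" using \<delta>(2) by (simp add: algebra_simps)
  next
    have "cmod \<epsilon> \<le> \<delta> + \<delta>^2" using cmod_le[of \<epsilon>] \<delta>(1) by (simp add: \<epsilon>_def)
    moreover have "\<delta>^2 \<le> 1 * \<delta>" unfolding power2_eq_square using d16 \<delta>(1) by (intro mult_right_mono) auto
    ultimately have "cmod \<epsilon> \<le> 1 / 4" using d16 by linarith
    moreover have "cmod (\<epsilon> * z ^ (p - 1)) \<le> cmod \<epsilon>"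
      using z by (simp add: norm_mult norm_power mult_left_le power_le_one)
    ultimately show "cmod (\<epsilon> * z ^ (p - 1)) \<le> 1 / 4" by linarith
  qed
  also have "\<dots> < real (p - 1)" using p by (simp add: of_nat_diff field_simps)
  finally show False by simp
qed

text \<open>The polynomial vanishes at \<open>1\<close>. As \<open>\<epsilon>\<close> is not real, its derivative there is not real either, so its real
part changes sign along the circle at \<open>1\<close>.\<close>

lemma trinomial_negative_real_part:
  fixes \<delta> :: real and p :: nat
  assumes p: "2 \<le> p" and \<delta>: "0 < \<delta>"
  defines "\<epsilon> \<equiv> Complex \<delta> (\<delta>^2)"
  obtains z where "cmod z = 1" "Re (1 - (1 - \<epsilon>) * z ^ (p - 1) - \<epsilon> * z ^ p) < 0"
proof -
  define F where "F = (\<lambda>\<theta>. Re (1 - (1 - \<epsilon>) * cis \<theta> ^ (p - 1) - \<epsilon> * cis \<theta> ^ p))"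
  define a where "a = real (p - 1)"
  have a: "real p = a + 1" using p by (simp add: a_def of_nat_diff)
  have pow_Re: "Re (cis x ^ k) = cos (real k * x)" for x k by (metis Complex.DeMoivre cis.sel(1))
  have pow_Im: "Im (cis x ^ k) = sin (real k * x)" for x k by (metis Complex.DeMoivre cis.sel(2))
  have F_eq: "F = (\<lambda>\<theta>. 1 - (1 - \<delta>) * cos (a * \<theta>) - \<delta>^2 * sin (a * \<theta>)
      - \<delta> * cos ((a + 1) * \<theta>) + \<delta>^2 * sin ((a + 1) * \<theta>))"
    unfolding a[symmetric] by (simp add: F_def pow_Re pow_Im a_def fun_eq_iff \<epsilon>_def)
  have cos: "((\<lambda>\<theta>. cos (k * \<theta>)) has_real_derivative 0) (at 0)" for k :: real
    by (rule DERIV_cong[OF DERIV_fun_cos[OF DERIV_cmult_Id]]) simp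
  have sin: "((\<lambda>\<theta>. sin (k * \<theta>)) has_real_derivative k) (at 0)" for k :: real
    by (rule DERIV_cong[OF DERIV_fun_sin[OF DERIV_cmult_Id]]) simp
  have "(F has_real_derivative 0 - (1 - \<delta>) * 0 - \<delta>^2 * a - \<delta> * 0 + \<delta>^2 * (a + 1)) (at 0)"
    unfolding F_eq by (intro DERIV_add DERIV_diff DERIV_cmult DERIV_const cos sin)
  then have "(F has_real_derivative \<delta>^2) (at 0)" by (simp add: algebra_simps)
  then obtain d where d: "d > 0" "\<And>h. 0 < h \<Longrightarrow> h < d \<Longrightarrow> F (0 - h) < F 0"
    using DERIV_pos_inc_left[of F "\<delta>^2" 0] \<delta> by auto
  have "F (0 - d / 2) < F 0" using d by (intro d(2)) auto
  then have "Re (1 - (1 - \<epsilon>) * cis (- d / 2) ^ (p - 1) - \<epsilon> * cis (- d / 2) ^ p) < 0"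
    by (simp add: F_def)
  then show ?thesis by (intro that[of "cis (- d / 2)"]) auto
qed

lemma one_variable_coeff_poly:
  "coeff_poly 1 r (\<lambda>\<gamma>. C (\<gamma> 1)) z = 1 + (\<Sum>k=1..r 1. C k * z 1 ^ k)"
proof -
  have "(\<Sum>\<alpha>\<in>multi_indices 1 r. C (\<alpha> 1) * monomial_value 1 \<alpha> z) = (\<Sum>k=1..r 1. C k * z 1 ^ k)"
  proof (rule sum.reindex_bij_witness[of _ "\<lambda>k. \<lambda>j\<in>{1..1}. k" "\<lambda>\<gamma>. \<gamma> 1"])
    fix \<gamma> assume g: "\<gamma> \<in> multi_indices 1 r"
    obtain j where "j \<in> {1..1}" "\<gamma> j \<noteq> 0" using g by (rule multi_index_nonzero)
    then have "\<gamma> 1 \<noteq> 0" by simp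
    moreover have "\<gamma> 1 \<le> r 1" using g by (simp add: multi_indices_def PiE_iff)
    ultimately show "\<gamma> 1 \<in> {1..r 1}" by simp
    show "(\<lambda>j\<in>{1..1}. \<gamma> 1) = \<gamma>"
      using g by (auto simp: multi_indices_def PiE_iff extensional_def restrict_def fun_eq_iff)
  next
    fix k assume "k \<in> {1..r 1}"
    then show "(\<lambda>j\<in>{1..1}. k) \<in> multi_indices 1 r"
      by (intro multi_indicesI[where j = 1]) auto
  qed (auto simp: monomial_value_def)
  then show ?thesis by (simp add: coeff_poly_def)
qed

text \<open>With all weights \<open>1\<close> and \<open>\<kappa> = p - 1\<close>, no index has weight \<open>2 \<kappa>\<close>, so the tetrablock is convex in the last
two coordinates. The trinomial \<open>q\<close>, with its argument scaled by \<open>\<rho> < 1\<close>, has a value \<open>R\<close> with negative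
real part at a point \<open>z0\<close> of the circle. For small \<open>h > 0\<close> some \<open>1 + b z ^ p\<close> with \<open>\<bar>b\<bar> < 1\<close> has the value
\<open>- h R\<close> at \<open>z0\<close>, and a convex combination of the two vanishes there.\<close>

lemma not_exhausted_one_variable:
  fixes c :: "nat \<Rightarrow> 'n::finite"
  assumes c: "bij_betw c {1..num_indices 1 r} (UNIV :: 'n set)" and r: "3 \<le> r 1"
  shows "\<not> exhausted_by_convex (gen_tetrablock 1 r c)"
proof
  assume exh: "exhausted_by_convex (gen_tetrablock 1 r c)"
  define p where "p = r 1"
  define \<delta> where "\<delta> = 1 / (8 * real p)"
  define \<epsilon> where "\<epsilon> = Complex \<delta> (\<delta>^2)"
  have p: "3 \<le> p" using r by (simp add: p_def)
  have \<delta>: "0 < \<delta>" "\<delta> * (8 * p) \<le> 1" using p by (simp_all add: \<delta>_def)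
  define q where "q = (\<lambda>z. 1 - (1 - \<epsilon>) * z ^ (p - 1) - \<epsilon> * z ^ p)"
  have q_nz: "q z \<noteq> 0" if "cmod z < 1" for z
    using trinomial_zero_free[OF _ \<delta> that] p by (simp add: q_def \<epsilon>_def)
  obtain z0 where z0: "cmod z0 = 1" "Re (q z0) < 0"
    using trinomial_negative_real_part[of p \<delta>] p \<delta>(1) unfolding q_def \<epsilon>_def by auto
  have "((\<lambda>\<rho>. Re (q (complex_of_real \<rho> * z0))) \<longlongrightarrow> Re (q (of_real 1 * z0))) (at_left 1)"
    unfolding q_def by (intro tendsto_intros)
  then have "((\<lambda>\<rho>. Re (q (complex_of_real \<rho> * z0))) \<longlongrightarrow> Re (q z0)) (at_left 1)" by simp
  then have "\<forall>\<^sub>F \<rho> in at_left 1. Re (q (complex_of_real \<rho> * z0)) < 0"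
    using z0(2) by (rule order_tendstoD)
  moreover have "\<forall>\<^sub>F \<rho> in at_left (1::real). \<rho> \<in> {0<..<1}"
    by (rule eventually_at_leftI[of 0]) auto
  ultimately have "\<forall>\<^sub>F \<rho> in at_left 1. Re (q (complex_of_real \<rho> * z0)) < 0 \<and> \<rho> \<in> {0<..<1}"
    by (rule eventually_conj)
  from eventually_happens'[OF trivial_limit_at_left_real this]
  obtain \<rho> :: real where \<rho>: "0 < \<rho>" "\<rho> < 1" "Re (q (of_real \<rho> * z0)) < 0" by auto
  \<comment> \<open>\<open>h\<close> minimizes \<open>\<bar>1 + h R\<bar>\<close>, which is less than \<open>1\<close> because \<open>Re R < 0\<close>.\<close>
  define R where "R = q (of_real \<rho> * z0)"
  define h where "h = - Re R / (cmod R)^2"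
  have R: "Re R < 0" "R \<noteq> 0" using \<rho>(3) by (auto simp: R_def)
  have h: "0 < h" using R by (simp add: h_def divide_neg_pos)
  have hR: "cmod (1 + of_real h * R) < 1"
  proof -
    have "(cmod (1 + of_real h * R))^2 = 1 + 2 * h * Re R + h^2 * (cmod R)^2"
      by (simp only: cmod_power2) (simp add: power2_eq_square algebra_simps)
    also have "\<dots> = 1 + h * Re R" using R(2) by (simp add: h_def power2_eq_square field_simps)
    also have "\<dots> < 1^2" using h R(1) by (simp add: mult_pos_neg)
    finally show ?thesis by (rule power2_less_imp_less) simp
  qed
  define b where "b = - (1 + of_real h * R) / z0 ^ p"
  have bz: "b * z0 ^ p = - (1 + of_real h * R)" using z0(1) by (auto simp: b_def)
  have b1: "cmod b < 1" using hR z0(1) unfolding b_def by (simp only: norm_divide norm_minus_cancel norm_power) simp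
  define A where "A = (\<lambda>k. if k = p - 1 then - (1 - \<epsilon>) * of_real \<rho> ^ (p - 1)
      else if k = p then - \<epsilon> * of_real \<rho> ^ p else 0)"
  define B where "B = (\<lambda>k. if k = p then b else 0)"
  have sum_top: "(\<Sum>k=1..r 1. C k * w ^ k) = C (p - 1) * w ^ (p - 1) + C p * w ^ p"
    if "\<And>k. k < p - 1 \<Longrightarrow> C k = 0" for C and w :: complex
  proof -
    have "(\<Sum>k=1..r 1. C k * w ^ k) = (\<Sum>k\<in>{p - 1, p}. C k * w ^ k)"
    proof (intro sum.mono_neutral_right ballI)
      fix i assume "i \<in> {1..r 1} - {p - 1, p}"
      then have "i < p - 1" by (auto simp: p_def)
      then show "C i * w ^ i = 0" using that by simp
    qed (use p in \<open>auto simp: p_def\<close>)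
    then show ?thesis using p by auto
  qed
  have A_poly: "coeff_poly 1 r (\<lambda>\<gamma>. A (\<gamma> 1)) z = q (of_real \<rho> * z 1)" for z
    unfolding one_variable_coeff_poly using p
    by (subst sum_top) (auto simp: A_def q_def power_mult_distrib algebra_simps)
  have B_poly: "coeff_poly 1 r (\<lambda>\<gamma>. B (\<gamma> 1)) z = 1 + b * z 1 ^ p" for z
    unfolding one_variable_coeff_poly using p by (subst sum_top) (auto simp: B_def)
  have A_zf: "zero_free 1 r (\<lambda>\<gamma>. A (\<gamma> 1))"
    unfolding zero_free_def A_poly
  proof
    fix z :: "nat \<Rightarrow> complex" assume "z \<in> {1..1} \<rightarrow> cball 0 1"
    then have "cmod (z 1) \<le> 1" by auto
    then have "\<rho> * cmod (z 1) \<le> \<rho> * 1" using \<rho>(1) by (intro mult_left_mono) auto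
    then have "cmod (of_real \<rho> * z 1) < 1" using \<rho>(1,2) by (simp only: norm_mult norm_of_real)
    then show "q (of_real \<rho> * z 1) \<noteq> 0" by (rule q_nz)
  qed
  have B_zf: "zero_free 1 r (\<lambda>\<gamma>. B (\<gamma> 1))"
    unfolding zero_free_def B_poly
  proof
    fix z :: "nat \<Rightarrow> complex" assume "z \<in> {1..1} \<rightarrow> cball 0 1"
    then have "cmod (z 1 ^ p) \<le> 1" by (auto simp: norm_power power_le_one)
    then have "cmod (b * z 1 ^ p) < 1"
      using b1 by (simp add: norm_mult) (meson le_less_trans mult_left_le norm_ge_zero)
    then show "1 + b * z 1 ^ p \<noteq> 0" by (rule one_plus_nonzero)
  qed
  define t where "t = 1 / (1 + h)"
  have t: "0 \<le> t" "t \<le> 1" using h by (simp_all add: t_def)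
  have wt: "weight 1 (\<lambda>_. 1) \<gamma> = \<gamma> 1" for \<gamma> by (simp add: weight_def)
  have le_p: "\<gamma> 1 \<le> p" if "\<gamma> \<in> multi_indices 1 r" for \<gamma>
    using that by (auto simp: multi_indices_def PiE_iff p_def)
  have "\<exists>Y. (\<forall>\<gamma>\<in>multi_indices 1 r. weight 1 (\<lambda>_. 1) \<gamma> < 2 * (p - 1) \<longrightarrow> Y \<gamma> = 0) \<and>
      zero_free 1 r (\<lambda>\<gamma>. of_real (1 - t) * A (\<gamma> 1) + of_real t * B (\<gamma> 1) + Y \<gamma>) \<and>
      zero_free 1 r (\<lambda>\<gamma>. of_real (1 - t) * A (\<gamma> 1) + of_real t * B (\<gamma> 1) + Y \<gamma>)"
  proof (rule gen_tetrablock_convex_combination[OF c exh _ _ _ t A_zf B_zf A_zf B_zf])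
    show "weight 1 (\<lambda>_. 1) \<gamma> \<le> 2 * (p - 1)" if "\<gamma> \<in> multi_indices 1 r" for \<gamma>
      using le_p[OF that] p unfolding wt by simp
  qed (use p in \<open>auto simp: weight_def A_def B_def\<close>)
  then obtain Y where Y: "\<And>\<gamma>. \<gamma> \<in> multi_indices 1 r \<Longrightarrow> weight 1 (\<lambda>_. 1) \<gamma> < 2 * (p - 1) \<Longrightarrow> Y \<gamma> = 0"
    "zero_free 1 r (\<lambda>\<gamma>. of_real (1 - t) * A (\<gamma> 1) + of_real t * B (\<gamma> 1) + Y \<gamma>)"
    by blast
  have Y0: "Y \<gamma> = 0" if "\<gamma> \<in> multi_indices 1 r" for \<gamma>
  proof (rule Y(1)[OF that])
    show "weight 1 (\<lambda>_. 1) \<gamma> < 2 * (p - 1)" using le_p[OF that] p unfolding wt by simp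
  qed
  let ?z = "\<lambda>_ :: nat. z0"
  have "coeff_poly 1 r (\<lambda>\<gamma>. of_real (1 - t) * A (\<gamma> 1) + of_real t * B (\<gamma> 1) + Y \<gamma>) ?z
      = of_real (1 - t) * coeff_poly 1 r (\<lambda>\<gamma>. A (\<gamma> 1)) ?z + of_real t * coeff_poly 1 r (\<lambda>\<gamma>. B (\<gamma> 1)) ?z"
    by (simp add: coeff_poly_def Y0 algebra_simps sum.distrib sum_distrib_left sum_subtractf)
  also have "\<dots> = of_real (1 - t) * R - of_real (t * h) * R"
    unfolding A_poly B_poly bz R_def[symmetric] by (simp add: algebra_simps)
  also have "\<dots> = 0" using h by (simp add: t_def field_simps flip: of_real_mult)
  finally show False using Y(2) z0(1) by (auto simp: zero_free_def)
qed

section \<open>All cases\<close>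

text \<open>Split \<open>r\<close> into its first entry \<open>\<alpha>\<close> and the rest \<open>\<beta>\<close>. The weights make both sides weigh \<open>r\<^sub>1 (r\<^sub>2 + \<dots> + r\<^sub>s)\<close>.
Taking roots in the first two variables gives \<open>z\<^sup>\<alpha>\<close> and \<open>z\<^sup>\<beta>\<close> any common value.\<close>

lemma not_exhausted_several_variables:
  fixes c :: "nat \<Rightarrow> 'n::finite"
  assumes c: "bij_betw c {1..num_indices s r} (UNIV :: 'n set)" and s: "2 \<le> s"
    and r: "\<And>j. j \<in> {1..s} \<Longrightarrow> 1 \<le> r j"
  shows "\<not> exhausted_by_convex (gen_tetrablock s r c)"
proof -
  define \<alpha> where "\<alpha> = (\<lambda>j\<in>{1..s}. if j = 1 then r 1 else 0)"
  define \<beta> where "\<beta> = (\<lambda>j\<in>{1..s}. if j = 1 then 0 else r j)"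
  define m where "m = (\<lambda>j::nat. if j = 1 then (\<Sum>j=2..s. r j) else r 1)"
  have ivl: "{1..s} = insert 1 {2..s}" "{2..s} = insert 2 {3..s}" using s by auto
  have mi: "\<alpha> \<in> multi_indices s r"
    by (rule multi_indicesI[where j = 1]) (use s r[of 1] in \<open>auto simp: \<alpha>_def\<close>)
  have mi': "\<beta> \<in> multi_indices s r"
    by (rule multi_indicesI[where j = 2]) (use s r[of 2] in \<open>auto simp: \<beta>_def\<close>)
  show ?thesis
  proof (rule not_exhausted_of_balanced_split[OF c _ mi mi'])
    show "1 \<le> m j" if "j \<in> {1..s}" for j
      using r[of 1] r[of 2] s by (auto simp: m_def ivl(2))
    show "\<alpha> j + \<beta> j = r j" if "j \<in> {1..s}" for j using that by (simp add: \<alpha>_def \<beta>_def)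
    have "weight s m \<alpha> = (\<Sum>j=2..s. r j) * r 1"
      unfolding weight_def ivl(1) using s by (simp add: \<alpha>_def m_def)
    moreover have "weight s m \<beta> = (\<Sum>j=2..s. r 1 * r j)"
      unfolding weight_def ivl(1) using s by (simp add: \<beta>_def m_def)
    ultimately show "weight s m \<alpha> = weight s m \<beta>" by (simp add: sum_distrib_left mult.commute)
    fix \<zeta> :: complex assume \<zeta>: "cmod \<zeta> \<le> 1"
    have root: "\<exists>w. w ^ k = \<zeta> \<and> cmod w \<le> 1" if "1 \<le> k" for k
    proof -
      have "k \<noteq> 0" using that by simp
      then obtain w where w: "\<zeta> = w ^ k" using exists_complex_root[of k \<zeta>] by metis
      then have "cmod w ^ k \<le> 1 ^ k" using \<zeta> by (simp add: norm_power)
      then have "cmod w \<le> 1" using that power_mono_iff[of "cmod w" 1 k] by simp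
      then show ?thesis using w by auto
    qed
    obtain u v where u: "u ^ r 1 = \<zeta>" "cmod u \<le> 1" and v: "v ^ r 2 = \<zeta>" "cmod v \<le> 1"
      using root[OF r[of 1]] root[OF r[of 2]] s by auto
    define z where "z = (\<lambda>j::nat. if j = 1 then u else if j = 2 then v else 1)"
    have "monomial_value s \<alpha> z = \<zeta>"
      unfolding monomial_value_def ivl(1) using s u by (simp add: \<alpha>_def z_def)
    moreover have "monomial_value s \<beta> z = \<zeta>"
      unfolding monomial_value_def ivl using s v by (simp add: \<beta>_def z_def)
    moreover have "z \<in> {1..s} \<rightarrow> cball 0 1" using u v by (simp add: z_def)
    ultimately show "\<exists>z\<in>{1..s} \<rightarrow> cball 0 1. monomial_value s \<alpha> z = \<zeta> \<and> monomial_value s \<beta> z = \<zeta>" by blast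
  qed
qed

lemma not_exhausted_symmetrized_bidisc:
  fixes c :: "nat \<Rightarrow> 'n::finite"
  assumes c: "bij_betw c {1..num_indices 1 r} (UNIV :: 'n set)" and r: "r 1 = 2"
  shows "\<not> exhausted_by_convex (gen_tetrablock 1 r c)"
proof -
  define \<alpha> where "\<alpha> = (\<lambda>j\<in>{1..1::nat}. 1::nat)"
  have mi: "\<alpha> \<in> multi_indices 1 r"
    by (rule multi_indicesI[where j = 1]) (use r in \<open>auto simp: \<alpha>_def\<close>)
  show ?thesis
  proof (rule not_exhausted_of_balanced_split[OF c _ mi mi, where m = "\<lambda>_. 1"])
    show "\<exists>z\<in>{1..1} \<rightarrow> cball 0 1. monomial_value 1 \<alpha> z = \<zeta> \<and> monomial_value 1 \<alpha> z = \<zeta>"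
      if "cmod \<zeta> \<le> 1" for \<zeta>
      using that by (intro bexI[of _ "\<lambda>_. \<zeta>"]) (auto simp: monomial_value_def \<alpha>_def)
  qed (use r in \<open>auto simp: \<alpha>_def\<close>)
qed

theorem theorem3p12:
  fixes n s :: nat and r :: "nat \<Rightarrow> nat" and c :: "nat \<Rightarrow> 'n::finite"
  assumes "n \<ge> 2" and "1 \<le> s" and "s \<le> n"
    and "\<And>j. j \<in> {1..s} \<Longrightarrow> r j \<ge> 1"
    and "(\<Sum>j=1..s. r j) = n"
    and "bij_betw c {1..num_indices s r} (UNIV :: 'n set)"
  shows "\<not> exhausted_by_convex (gen_tetrablock s r c)"
proof (cases "2 \<le> s")
  case True
  then show ?thesis using not_exhausted_several_variables assms(4,6) by blast
next
  case False
  then have s: "s = 1" using assms(2) by simp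
  then have "r 1 = n" using assms(5) by simp
  then consider "r 1 = 2" | "3 \<le> r 1" using assms(1) by linarith
  then show ?thesis
  proof cases
    case 1
    then show ?thesis using not_exhausted_symmetrized_bidisc assms(6) unfolding s by blast
  next
    case 2
    then show ?thesis using not_exhausted_one_variable assms(6) unfolding s by blast
  qed
qed

end
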